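(* Fix a weight $\lambda\in\Lambda$ and an integer $k$. Then the family of operators on $\tilde K_T(G/B)$ $$R_\alpha=X^{k\alpha}+X^{(\lambda,\alpha^\vee)\alpha}B_\alpha=X^\lambda(X^{k\alpha}+B_\alpha)X^{-\lambda},\qquad \alpha\in\Phi,$$ is an $R$-matrix, i.e. satisfies $R_{-\alpha}=R_\alpha^{-1}$ and the Yang–Baxter equation.
   Context: $G$ connected, simply connected, simple complex Lie group, Borel $B\supset T$, irreducible root system $\Phi$, positive roots $\Phi^+$, coroots $\alpha^\vee=2\alpha/(\alpha,\alpha)$, Weyl group $W$ with length $\ell$, weight lattice $\Lambda$, $\rho$ the sum of fundamental weights, $\theta^\vee$ the highest coroot, $h=(\rho,\theta^\vee)+1$ the Coxeter number. $K_T(G/B)$ is a free $\mathbb Z[X]$-module ($\mathbb Z[X]$ = group algebra of $\Lambda$ with basis $x^\mu$) with basis $[\mathcal O_w]:=*[\mathcal O_{X_w}]$, $w\in W$ ($X_w=\overline{BwB/B}$, $*$ the dualizing involution). Let $\mathbb Z[\tilde X]$ be the group algebra of $\Lambda/h=\{\lambda/h\}$ (basis $x^{\lambda/h}$) and $\tilde K_T(G/B)=K_T(G/B)\otimes_{\mathbb Z[X]}\mathbb Z[\tilde X]$, with $\mathbb Z[\tilde X]$-basis $[\mathcal O_w]$. For $\alpha\in\Phi^+$ the Bruhat operator $B_\alpha$ is the $\mathbb Z[\tilde X]$-linear map $[\mathcal O_w]\mapsto[\mathcal O_{ws_\alpha}]$ if $\ell(ws_\alpha)=\ell(w)-1$,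 $\mapsto0$ otherwise; $B_\alpha:=-B_{-\alpha}$ for $\alpha\in\Phi^-$. For $\lambda\in\Lambda$, $X^\lambda$ is the $\mathbb Z[\tilde X]$-linear map $[\mathcal O_w]\mapsto x^{w(\lambda)/h}[\mathcal O_w]$. $R$-matrix: a collection of invertible operators $\{R_\alpha:\alpha\in\Phi\}$ with $R_{-\alpha}=R_\alpha^{-1}$ and, for every $\alpha,\beta\in\Phi$ with $(\alpha,\beta)\le0$, $R_\alpha R_{s_\alpha(\beta)}R_{s_\alpha s_\beta(\alpha)}\cdots R_{s_\beta(\alpha)}R_\beta=R_\beta R_{s_\beta(\alpha)}\cdots R_{s_\alpha s_\beta(\alpha)}R_{s_\alpha(\beta)}R_\alpha$, the products running over the $m$ roots of the rank-2 subsystem generated by $\alpha,\beta$ that are nonnegative combinations of $\alpha,\beta$ in the order $\alpha,s_\alpha(\beta),\dots,s_\beta(\alpha),\beta$ ($2m$ the order of $\langle s_\alpha,s_\beta\rangle$). *)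

theory Defs
  imports "HOL-Analysis.Analysis" "HOL-Library.Poly_Mapping"
begin

definition coroot :: "'v::euclidean_space \<Rightarrow> 'v" where
  "coroot a = (2 / (a \<bullet> a)) *\<^sub>R a"

definition refl :: "'v::euclidean_space \<Rightarrow> 'v \<Rightarrow> 'v" where
  "refl a v = v - (v \<bullet> coroot a) *\<^sub>R a"

definition irreducible_root_system :: "'v::euclidean_space set \<Rightarrow> bool" where
  "irreducible_root_system \<Phi> \<longleftrightarrow>
     finite \<Phi> \<and> \<Phi> \<noteq> {} \<and> 0 \<notin> \<Phi> \<and> span \<Phi> = UNIV \<and>
     (\<forall>a\<in>\<Phi>. refl a ` \<Phi> = \<Phi>) \<and>
     (\<forall>a\<in>\<Phi>. \<forall>b\<in>\<Phi>. b \<bullet> coroot a \<in> \<int>) \<and>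
     (\<forall>a\<in>\<Phi>. \<forall>c::real. c *\<^sub>R a \<in> \<Phi> \<longrightarrow> c = 1 \<or> c = -1) \<and>
     \<not> (\<exists>A B. A \<noteq> {} \<and> B \<noteq> {} \<and> A \<union> B = \<Phi> \<and> (\<forall>a\<in>A. \<forall>b\<in>B. a \<bullet> b = 0))"

text \<open>Positive roots w.r.t. a regular vector \<open>\<xi>\<close> (the choice of Borel \<open>B\<close>).\<close>
definition pos_roots :: "'v::euclidean_space set \<Rightarrow> 'v \<Rightarrow> 'v set" where
  "pos_roots \<Phi> \<xi> = {a\<in>\<Phi>. a \<bullet> \<xi> > 0}"

definition simple_roots :: "'v::euclidean_space set \<Rightarrow> 'v \<Rightarrow> 'v set" where
  "simple_roots \<Phi> \<xi> = {a \<in> pos_roots \<Phi> \<xi>.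
      \<not> (\<exists>b\<in>pos_roots \<Phi> \<xi>. \<exists>c\<in>pos_roots \<Phi> \<xi>. a = b + c)}"

definition weight_lattice :: "'v::euclidean_space set \<Rightarrow> 'v set" where
  "weight_lattice \<Phi> = {l. \<forall>a\<in>\<Phi>. l \<bullet> coroot a \<in> \<int>}"

definition fund_weight :: "'v::euclidean_space set \<Rightarrow> 'v \<Rightarrow> 'v \<Rightarrow> 'v" where
  "fund_weight \<Phi> \<xi> a = (THE w. \<forall>b\<in>simple_roots \<Phi> \<xi>.
      w \<bullet> coroot b = (if b = a then 1 else 0))"

definition rho :: "'v::euclidean_space set \<Rightarrow> 'v \<Rightarrow> 'v" where
  "rho \<Phi> \<xi> = (\<Sum>a\<in>simple_roots \<Phi> \<xi>. fund_weight \<Phi> \<xi> a)"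

definition coroot_cone :: "'v::euclidean_space set \<Rightarrow> 'v \<Rightarrow> 'v set" where
  "coroot_cone \<Phi> \<xi> = {(\<Sum>a\<in>simple_roots \<Phi> \<xi>. of_nat (n a) *\<^sub>R coroot a) | n :: 'v \<Rightarrow> nat. True}"

definition highest_coroot :: "'v::euclidean_space set \<Rightarrow> 'v \<Rightarrow> 'v" where
  "highest_coroot \<Phi> \<xi> = (THE t. t \<in> coroot ` \<Phi> \<and>
      (\<forall>c\<in>coroot ` \<Phi>. t - c \<in> coroot_cone \<Phi> \<xi>))"

definition coxeter_number :: "'v::euclidean_space set \<Rightarrow> 'v \<Rightarrow> real" where
  "coxeter_number \<Phi> \<xi> = rho \<Phi> \<xi> \<bullet> highest_coroot \<Phi> \<xi> + 1"

definition prod_refl :: "'v::euclidean_space list \<Rightarrow> 'v \<Rightarrow> 'v" where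
  "prod_refl ls = foldr (\<lambda>a g. refl a \<circ> g) ls id"

definition weyl :: "'v::euclidean_space set \<Rightarrow> ('v \<Rightarrow> 'v) set" where
  "weyl \<Phi> = {prod_refl ls | ls. set ls \<subseteq> \<Phi>}"

definition wlen :: "'v::euclidean_space set \<Rightarrow> 'v \<Rightarrow> ('v \<Rightarrow> 'v) \<Rightarrow> nat" where
  "wlen \<Phi> \<xi> w = (LEAST n. \<exists>ls. length ls = n \<and> set ls \<subseteq> simple_roots \<Phi> \<xi> \<and> w = prod_refl ls)"

text \<open>The group ring \<open>\<int>[V]\<close> of the ambient space; \<open>x^\<mu>\<close> is \<open>Poly_Mapping.single \<mu> 1\<close>.
  \<open>\<int>[\<tilde>X]\<close> is the subring of elements supported on \<open>\<Lambda>/h\<close>.\<close>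
definition xmon :: "'v::euclidean_space \<Rightarrow> 'v \<Rightarrow>\<^sub>0 int" where
  "xmon \<mu> = Poly_Mapping.single \<mu> 1"

definition Ztilde :: "'v::euclidean_space set \<Rightarrow> 'v \<Rightarrow> ('v \<Rightarrow>\<^sub>0 int) set" where
  "Ztilde \<Phi> \<xi> = {p. Poly_Mapping.keys p \<subseteq> {(1 / coxeter_number \<Phi> \<xi>) *\<^sub>R l | l. l \<in> weight_lattice \<Phi>}}"

text \<open>Elements of \<open>\<tilde>K_T(G/B)\<close>: coordinate functions \<open>f\<close> w.r.t. the basis \<open>[\<O>_w]\<close>, \<open>w \<in> W\<close>.\<close>
definition Kmod :: "'v::euclidean_space set \<Rightarrow> 'v \<Rightarrow> (('v \<Rightarrow> 'v) \<Rightarrow> ('v \<Rightarrow>\<^sub>0 int)) set" where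
  "Kmod \<Phi> \<xi> = {f. (\<forall>u. u \<notin> weyl \<Phi> \<longrightarrow> f u = 0) \<and> (\<forall>u. f u \<in> Ztilde \<Phi> \<xi>)}"

text \<open>Bruhat operator for a positive root: \<open>[\<O>_w] \<mapsto> [\<O>_{w s_\<alpha>}]\<close> if \<open>\<ell>(w s_\<alpha>) = \<ell>(w) - 1\<close>.\<close>
definition Bpos :: "'v::euclidean_space set \<Rightarrow> 'v \<Rightarrow> 'v \<Rightarrow> (('v \<Rightarrow> 'v) \<Rightarrow> ('v \<Rightarrow>\<^sub>0 int)) \<Rightarrow> (('v \<Rightarrow> 'v) \<Rightarrow> ('v \<Rightarrow>\<^sub>0 int))" where
  "Bpos \<Phi> \<xi> a f = (\<lambda>u. \<Sum>w\<in>weyl \<Phi>.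
      if w \<circ> refl a = u \<and> wlen \<Phi> \<xi> (w \<circ> refl a) + 1 = wlen \<Phi> \<xi> w then f w else 0)"

definition Bop :: "'v::euclidean_space set \<Rightarrow> 'v \<Rightarrow> 'v \<Rightarrow> (('v \<Rightarrow> 'v) \<Rightarrow> ('v \<Rightarrow>\<^sub>0 int)) \<Rightarrow> (('v \<Rightarrow> 'v) \<Rightarrow> ('v \<Rightarrow>\<^sub>0 int))" where
  "Bop \<Phi> \<xi> a f = (if a \<in> pos_roots \<Phi> \<xi> then Bpos \<Phi> \<xi> a f else (\<lambda>u. - Bpos \<Phi> \<xi> (-a) f u))"

definition Xop :: "'v::euclidean_space set \<Rightarrow> 'v \<Rightarrow> 'v \<Rightarrow> (('v \<Rightarrow> 'v) \<Rightarrow> ('v \<Rightarrow>\<^sub>0 int)) \<Rightarrow> (('v \<Rightarrow> 'v) \<Rightarrow> ('v \<Rightarrow>\<^sub>0 int))" where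
  "Xop \<Phi> \<xi> l f = (\<lambda>u. xmon ((1 / coxeter_number \<Phi> \<xi>) *\<^sub>R u l) * f u)"

definition Rop :: "'v::euclidean_space set \<Rightarrow> 'v \<Rightarrow> 'v \<Rightarrow> int \<Rightarrow> 'v \<Rightarrow> (('v \<Rightarrow> 'v) \<Rightarrow> ('v \<Rightarrow>\<^sub>0 int)) \<Rightarrow> (('v \<Rightarrow> 'v) \<Rightarrow> ('v \<Rightarrow>\<^sub>0 int))" where
  "Rop \<Phi> \<xi> l k a f = (\<lambda>u. Xop \<Phi> \<xi> (of_int k *\<^sub>R a) f u
        + Xop \<Phi> \<xi> ((l \<bullet> coroot a) *\<^sub>R a) (Bop \<Phi> \<xi> a f) u)"

definition dihedral_m :: "'v::euclidean_space \<Rightarrow> 'v \<Rightarrow> nat" where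
  "dihedral_m a b = (LEAST n. n > 0 \<and> (refl a \<circ> refl b) ^^ n = id)"

text \<open>The sequence \<open>\<alpha>, s_\<alpha>(\<beta>), s_\<alpha>s_\<beta>(\<alpha>), \<dots>, s_\<beta>(\<alpha>), \<beta>\<close> (\<open>m\<close> terms).\<close>
definition rank2_seq :: "'v::euclidean_space \<Rightarrow> 'v \<Rightarrow> 'v list" where
  "rank2_seq a b = map (\<lambda>i. if even i then ((refl a \<circ> refl b) ^^ (i div 2)) a
                              else ((refl a \<circ> refl b) ^^ (i div 2)) (refl a b))
                       [0..<dihedral_m a b]"

definition op_prod :: "('r \<Rightarrow> 'x \<Rightarrow> 'x) \<Rightarrow> 'r list \<Rightarrow> 'x \<Rightarrow> 'x" where
  "op_prod R gs = foldr (\<lambda>g F. R g \<circ> F) gs id"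

end

theory Submission
  imports Defs
begin

text \<open>
  Writing \<open>T_\<alpha> = 1 + B_\<alpha>\<close> and letting \<open>\<gamma>_1, \<dots>, \<gamma>_m\<close> be the roots of the rank 2 system in the given order,
  extended to all integer indices by \<open>\<gamma>_(i+m) = -\<gamma>_i\<close>, one has
  \<open>R_(\<gamma>_j) X^(\<lambda> + k \<tau>_(j+1)) = X^(\<lambda> + k \<tau>_j) T_(\<gamma>_j)\<close> with \<open>\<tau>_j = (\<gamma>_j + \<dots> + \<gamma>_(j+m-1)) / 2\<close>.
  Since \<open>\<tau>_(m+1) = -\<tau>_1\<close>, both sides of the Yang--Baxter equation are conjugated in the same way to the
  corresponding products of the \<open>T\<close>, so \<open>\<lambda>\<close> and \<open>k\<close> disappear. Rotating with \<open>T_(-\<alpha>) = T_\<alpha>\<^sup>-\<^sup>1\<close>, all \<open>\<gamma>_j\<close> may be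
  taken positive. On each coset of the dihedral group the length is then the number of inversions in
  the rank 2 system plus the number of the others, and the latter never decreases when one goes up;
  hence the coverings that survive in \<open>W\<close> are those along which it is constant, and expanding the two
  products from the top of the coset downwards gives the same sum.
\<close>

section \<open>Reflections, inversions and length\<close>

text \<open>The vectors \<open>\<tau>_j\<close> answer one condition:
  \<open>R_\<gamma> X^y = X^(y + k \<gamma>) T_\<gamma>\<close> holds as soon as
  \<open>y - \<lambda>\<close> pairs to \<open>-k\<close> with the coroot of
  \<open>\<gamma>\<close>. They need not be weights of \<open>\<Phi>\<close>, so the conjugation can
  leave \<open>Kmod\<close>; the identities are therefore proved for all functions on W with values
  in the group ring of the ambient space. The obstacle on a coset is that a covering of the dihedral
  group need not be a covering in W, so the coset does not carry the Bruhat operators of the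
  dihedral group itself. What saves the comparison is a dichotomy for two elements two levels apart:
  either their lengths differ by exactly 2, and then every intermediate element gives two coverings,
  or no intermediate element does. The order of two steps is thus irrelevant to survival. The number
  \<open>m\<close> stays general in this comparison, which treats all rank 2 types at once. The list
  of possible Cartan integers is used only to build the sequence \<open>\<gamma>\<close>.\<close>

lemma linear_refl: "linear (refl a)"
  unfolding refl_def by (rule linearI) (auto simp: inner_add_left algebra_simps)

lemma refl_self [simp]: "refl a a = - a"
  by (cases "a = 0") (auto simp: refl_def coroot_def scaleR_2)

lemma refl_refl [simp]: "refl a (refl a v) = v"
proof -
  have "refl a (refl a v) = refl a v - (v \<bullet> coroot a) *\<^sub>R refl a a"
    by (subst (2) refl_def) (simp add: linear_diff[OF linear_refl] linear_scale[OF linear_refl])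
  then show ?thesis by (simp add: refl_def)
qed

lemma refl_comp_refl_left [simp]: "w \<circ> refl a \<circ> refl a = w" by auto

lemma coroot_minus [simp]: "coroot (- a) = - coroot a"
  by (simp add: coroot_def)

lemma refl_minus_root [simp]: "refl (- a) = refl a"
  by (rule ext) (simp add: refl_def)

lemma inner_refl_left: "refl a v \<bullet> w = v \<bullet> refl a w"
  by (simp add: refl_def coroot_def inner_diff_left inner_diff_right inner_commute)

lemma inner_refl_refl [simp]: "refl a v \<bullet> refl a w = v \<bullet> w"
  by (simp add: inner_refl_left)

lemma refl_isometry:
  assumes "linear g" "\<And>x y. g x \<bullet> g y = x \<bullet> y"
  shows "refl (g a) (g v) = g (refl a v)"
  by (simp add: refl_def coroot_def assms linear_diff linear_scale)

lemma prod_refl_Nil [simp]: "prod_refl [] = id"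
  by (simp add: prod_refl_def)

lemma prod_refl_Cons [simp]: "prod_refl (a # ls) = refl a \<circ> prod_refl ls"
  by (simp add: prod_refl_def)

lemma prod_refl_append [simp]: "prod_refl (ls @ ls') = prod_refl ls \<circ> prod_refl ls'"
  by (induction ls) (auto simp: comp_assoc)

lemma linear_prod_refl: "linear (prod_refl ls)"
proof (induction ls)
  case Nil
  show ?case unfolding prod_refl_Nil id_def by (rule linear_ident)
next
  case (Cons a ls)
  then show ?case unfolding prod_refl_Cons by (rule linear_compose[OF _ linear_refl])
qed

lemma prod_refl_inner: "prod_refl ls x \<bullet> prod_refl ls y = x \<bullet> y"
  by (induction ls) auto

lemma weyl_linear: "w \<in> weyl \<Phi> \<Longrightarrow> linear w"
  by (auto simp: weyl_def linear_prod_refl)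

lemma weyl_inner: "w \<in> weyl \<Phi> \<Longrightarrow> w x \<bullet> w y = x \<bullet> y"
  by (auto simp: weyl_def prod_refl_inner)

lemma weyl_refl_conj: "w \<in> weyl \<Phi> \<Longrightarrow> refl (w a) (w v) = w (refl a v)"
  by (rule refl_isometry) (auto simp: weyl_linear weyl_inner)

lemma id_weyl [simp]: "id \<in> weyl \<Phi>"
  unfolding weyl_def by (rule CollectI, rule exI[of _ "[]"]) auto

lemma refl_weyl: "a \<in> \<Phi> \<Longrightarrow> refl a \<in> weyl \<Phi>"
  unfolding weyl_def by (rule CollectI, rule exI[of _ "[a]"]) auto

lemma comp_weyl: "w \<in> weyl \<Phi> \<Longrightarrow> w' \<in> weyl \<Phi> \<Longrightarrow> w \<circ> w' \<in> weyl \<Phi>"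
  unfolding weyl_def using prod_refl_append by (smt (verit) Un_subset_iff mem_Collect_eq set_append)

lemma comp_refl_weyl [simp]: "a \<in> \<Phi> \<Longrightarrow> w \<circ> refl a \<in> weyl \<Phi> \<longleftrightarrow> w \<in> weyl \<Phi>"
  using comp_weyl[OF _ refl_weyl] refl_comp_refl_left by metis

locale root_system =
  fixes \<Phi> :: "'v::euclidean_space set" and \<xi> :: 'v
  assumes irr: "irreducible_root_system \<Phi>"
    and regular: "\<And>a. a \<in> \<Phi> \<Longrightarrow> a \<bullet> \<xi> \<noteq> 0"
begin

lemma finite_roots: "finite \<Phi>" and zero_notin_roots: "0 \<notin> \<Phi>"
  and span_roots: "span \<Phi> = UNIV"
  using irr by (auto simp: irreducible_root_system_def)

lemma refl_closed: "a \<in> \<Phi> \<Longrightarrow> b \<in> \<Phi> \<Longrightarrow> refl a b \<in> \<Phi>"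
  using irr by (auto simp: irreducible_root_system_def)

lemma integral: "a \<in> \<Phi> \<Longrightarrow> b \<in> \<Phi> \<Longrightarrow> b \<bullet> coroot a \<in> \<int>"
  using irr by (auto simp: irreducible_root_system_def)

lemma reduced: "a \<in> \<Phi> \<Longrightarrow> c *\<^sub>R a \<in> \<Phi> \<Longrightarrow> c = 1 \<or> c = -1"
  using irr by (auto simp: irreducible_root_system_def)

lemma uminus_closed [simp]: "- a \<in> \<Phi> \<longleftrightarrow> a \<in> \<Phi>"
  using refl_closed[of a a] refl_closed[of "-a" "-a"] unfolding refl_self by auto

lemma weyl_root: "w \<in> weyl \<Phi> \<Longrightarrow> a \<in> \<Phi> \<Longrightarrow> w a \<in> \<Phi>"
proof -
  have "set ls \<subseteq> \<Phi> \<Longrightarrow> a \<in> \<Phi> \<Longrightarrow> prod_refl ls a \<in> \<Phi>" for ls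
    by (induction ls) (auto intro: refl_closed)
  then show "w \<in> weyl \<Phi> \<Longrightarrow> a \<in> \<Phi> \<Longrightarrow> w a \<in> \<Phi>"
    by (auto simp: weyl_def)
qed

lemma pos_or_neg: "a \<in> \<Phi> \<Longrightarrow> a \<in> pos_roots \<Phi> \<xi> \<or> - a \<in> pos_roots \<Phi> \<xi>"
  using regular[of a] by (auto simp: pos_roots_def)

text \<open>A linear map is determined by its values on the finite spanning set
  \<open>\<Phi>\<close>, which W permutes.\<close>

lemma finite_weyl: "finite (weyl \<Phi>)"
proof -
  have "inj_on (\<lambda>w. restrict w \<Phi>) (weyl \<Phi>)"
  proof (rule inj_onI)
    fix w w' assume w: "w \<in> weyl \<Phi>" "w' \<in> weyl \<Phi>" and eq: "restrict w \<Phi> = restrict w' \<Phi>"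
    have "w x = w' x" for x
    proof (rule linear_eq_on_span[OF weyl_linear[OF w(1)] weyl_linear[OF w(2)]])
      show "w a = w' a" if "a \<in> \<Phi>" for a
        using fun_cong[OF eq, of a] that by simp
      show "x \<in> span \<Phi>" by (simp add: span_roots)
    qed
    then show "w = w'" by auto
  qed
  moreover have "(\<lambda>w. restrict w \<Phi>) ` weyl \<Phi> \<subseteq> \<Phi> \<rightarrow>\<^sub>E \<Phi>"
    by (auto simp: weyl_root)
  moreover have "finite (\<Phi> \<rightarrow>\<^sub>E \<Phi>)"
    by (simp add: finite_PiE finite_roots)
  ultimately show ?thesis by (meson finite_imageD finite_subset)
qed

text \<open>Strict Cauchy-Schwarz: equality would make \<open>b\<close> a multiple of
  \<open>a\<close>, and reducedness leaves only \<open>a\<close> and \<open>- a\<close>.\<close>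

lemma cartan_prod_less_4:
  assumes "a \<in> \<Phi>" "b \<in> \<Phi>" "b \<noteq> a" "b \<noteq> - a"
  shows "(b \<bullet> coroot a) * (a \<bullet> coroot b) < 4"
proof -
  have nz: "a \<noteq> 0" "b \<noteq> 0" using assms zero_notin_roots by auto
  have "\<bar>a \<bullet> b\<bar> \<noteq> norm a * norm b"
  proof
    assume "\<bar>a \<bullet> b\<bar> = norm a * norm b"
    then have "norm a *\<^sub>R b = norm b *\<^sub>R a \<or> norm a *\<^sub>R b = - norm b *\<^sub>R a"
      by (simp add: norm_cauchy_schwarz_abs_eq)
    then have "b = (norm b / norm a) *\<^sub>R a \<or> b = (- norm b / norm a) *\<^sub>R a"
      using nz by (metis (no_types, lifting) divide_inverse_commute norm_eq_zero scaleR_minus_left vector_fraction_eq_iff)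
    then show False
    proof
      assume "b = (norm b / norm a) *\<^sub>R a"
      then show False using reduced[OF assms(1), of "norm b / norm a"] assms(2-4) by (metis scaleR_minus1_left scaleR_one)
    next
      assume "b = (- norm b / norm a) *\<^sub>R a"
      then show False using reduced[OF assms(1), of "- norm b / norm a"] assms(2-4) by (metis scaleR_minus1_left scaleR_one)
    qed
  qed
  with Cauchy_Schwarz_ineq2[of a b] have "\<bar>a \<bullet> b\<bar> < norm a * norm b" by simp
  then have "(a \<bullet> b)\<^sup>2 < (norm a * norm b)\<^sup>2"
    by (metis abs_ge_zero power2_abs power_strict_mono zero_less_numeral)
  then have "(a \<bullet> b)\<^sup>2 < (a \<bullet> a) * (b \<bullet> b)"
    by (simp add: power_mult_distrib power2_norm_eq_inner)
  then show ?thesis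
    using nz by (simp add: coroot_def inner_commute field_simps power2_eq_square)
qed

text \<open>Two positive integers with product below 4 cannot both be at least 2. This bounds the
  root strings in \<open>simple_refl_pos\<close>.\<close>

lemma cartan_two:
  assumes "a \<in> \<Phi>" "b \<in> \<Phi>" "b \<noteq> a" "b \<bullet> coroot a \<ge> 2"
  shows "a \<bullet> coroot b = 1" "b \<bullet> coroot a < 4"
proof -
  have nz: "a \<noteq> 0" "b \<noteq> 0" using assms zero_notin_roots by auto
  have "b \<noteq> - a" using assms(4) nz by (auto simp: coroot_def)
  then have *: "(b \<bullet> coroot a) * (a \<bullet> coroot b) < 4" using cartan_prod_less_4 assms by blast
  obtain n where n: "a \<bullet> coroot b = of_int n" using integral[OF assms(2,1)] by (auto elim: Ints_cases)
  have "b \<bullet> coroot a > 0" using assms(4) by linarith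
  then have "a \<bullet> b > 0" using nz inner_gt_zero_iff[of a]
    by (auto simp: coroot_def inner_commute zero_less_divide_iff zero_less_mult_iff simp del: inner_gt_zero_iff)
  then have "a \<bullet> coroot b > 0" using nz by (simp add: coroot_def)
  then have "n \<ge> 1" using n by simp
  moreover have "n < 2"
  proof (rule ccontr)
    assume "\<not> n < 2"
    then have "a \<bullet> coroot b \<ge> 2" using n by simp
    then have "(b \<bullet> coroot a) * (a \<bullet> coroot b) \<ge> 2 * 2" using assms(4) by (intro mult_mono) auto
    then show False using * by simp
  qed
  ultimately show "a \<bullet> coroot b = 1" using n by simp
  then show "b \<bullet> coroot a < 4" using * by simp
qed

lemma pos_root_diff:
  assumes "a \<in> pos_roots \<Phi> \<xi>" "b \<in> pos_roots \<Phi> \<xi>" "refl a b \<notin> pos_roots \<Phi> \<xi>"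
  shows "b \<bullet> coroot a > 0" "- refl a b \<in> pos_roots \<Phi> \<xi>"
proof -
  have ab: "a \<in> \<Phi>" "b \<in> \<Phi>" using assms by (auto simp: pos_roots_def)
  then show "- refl a b \<in> pos_roots \<Phi> \<xi>" using pos_or_neg[OF refl_closed] assms(3) by blast
  then have "refl a b \<bullet> \<xi> < 0" by (auto simp: pos_roots_def)
  then have "b \<bullet> \<xi> < (b \<bullet> coroot a) * (a \<bullet> \<xi>)" by (simp add: refl_def inner_diff_left)
  moreover have "a \<bullet> \<xi> > 0" "b \<bullet> \<xi> > 0" using assms by (auto simp: pos_roots_def)
  ultimately show "b \<bullet> coroot a > 0" by (smt (verit) mult_nonneg_nonpos2)
qed

text \<open>Simple means indecomposable here, so no expansion in simple roots is at hand. If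
  \<open>- refl a b = n a - b\<close> were positive, with \<open>n\<close> one of 1, 2, 3, walking
  down the string \<open>b\<close>, \<open>b - a\<close>, \<open>b - 2 a\<close> would exhibit
  \<open>a\<close> as a sum of two positive roots.\<close>

lemma simple_refl_pos:
  assumes a: "a \<in> simple_roots \<Phi> \<xi>" and b: "b \<in> pos_roots \<Phi> \<xi>" and ne: "b \<noteq> a"
  shows "refl a b \<in> pos_roots \<Phi> \<xi>"
proof (rule ccontr)
  assume neg: "refl a b \<notin> pos_roots \<Phi> \<xi>"
  let ?P = "pos_roots \<Phi> \<xi>"
  have aP: "a \<in> ?P" and indec: "\<And>b c. b \<in> ?P \<Longrightarrow> c \<in> ?P \<Longrightarrow> a \<noteq> b + c"
    using a by (auto simp: simple_roots_def)
  have ab: "a \<in> \<Phi>" "b \<in> \<Phi>" using aP b by (auto simp: pos_roots_def)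
  have indec': "c \<in> ?P \<Longrightarrow> a - c \<notin> ?P" for c using indec[of c "a - c"] by auto
  have indec'': "c - a \<in> ?P" if "c \<in> ?P" "a - c \<in> \<Phi>" for c
    using indec'[of c] pos_or_neg[of "a - c"] that by auto
  obtain n where n: "b \<bullet> coroot a = of_int n" using integral[OF ab] by (auto elim: Ints_cases)
  note d = pos_root_diff[OF aP b neg]
  have dd: "- refl a b = of_int n *\<^sub>R a - b" by (simp add: refl_def n)
  have "n > 0" using d(1) n by simp
  show False
  proof (cases "n = 1")
    case True
    then show False using d(2) dd indec'[OF b] by simp
  next
    case False
    then have "b \<bullet> coroot a \<ge> 2" using \<open>n > 0\<close> n by simp
    note two = cartan_two[OF ab ne this]
    have "refl b a = a - b" by (simp add: refl_def two)
    then have "a - b \<in> \<Phi>" using refl_closed[OF ab(2,1)] by simp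
    then have e: "b - a \<in> ?P" using indec''[OF b] by blast
    have "n = 2 \<or> n = 3" using False \<open>n > 0\<close> two(2) n by auto
    then show False
    proof
      assume "n = 2"
      then have "- refl a b = a - (b - a)" by (simp add: dd scaleR_2)
      then show False using d(2) indec'[OF e] by simp
    next
      assume 3: "n = 3"
      have aa: "a \<bullet> coroot a = 2" using ab(1) zero_notin_roots by (auto simp: coroot_def)
      have "refl a (b - a) = (b - a) - a"
        using n 3 by (simp add: refl_def inner_diff_left aa)
      moreover have "b - a \<in> \<Phi>" using e by (simp add: pos_roots_def)
      ultimately have "a - (b - a) \<in> \<Phi>"
        using refl_closed[OF ab(1), of "b - a"] uminus_closed[of "b - a - a"] by simp
      then have e': "b - a - a \<in> ?P" using indec''[OF e] by blast
      have "- refl a b = a - (b - a - a)"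
        using 3 by (simp add: dd scaleR_left_distrib[of 1 2, simplified] scaleR_2 numeral_3_eq_3 algebra_simps)
      then show False using d(2) indec'[OF e'] by simp
    qed
  qed
qed

section \<open>Words in simple reflections and inversions\<close>

abbreviation "inversions w \<equiv> {b \<in> pos_roots \<Phi> \<xi>. w b \<bullet> \<xi> < 0}"

lemma finite_pos_roots: "finite (pos_roots \<Phi> \<xi>)"
  using finite_roots by (simp add: pos_roots_def)

lemma finite_inversions [simp]: "finite (inversions w)"
  using finite_pos_roots by simp

lemma simple_roots_pos: "simple_roots \<Phi> \<xi> \<subseteq> pos_roots \<Phi> \<xi>"
  by (auto simp: simple_roots_def)

lemma pos_roots_subset: "pos_roots \<Phi> \<xi> \<subseteq> \<Phi>"
  by (auto simp: pos_roots_def)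

lemma simple_roots_subset: "simple_roots \<Phi> \<xi> \<subseteq> \<Phi>"
  using simple_roots_pos pos_roots_subset by blast

lemma pos_root_induct [consumes 1, case_names simple sum]:
  assumes "b \<in> pos_roots \<Phi> \<xi>"
    and "\<And>a. a \<in> simple_roots \<Phi> \<xi> \<Longrightarrow> Q a"
    and "\<And>b c. b \<in> pos_roots \<Phi> \<xi> \<Longrightarrow> c \<in> pos_roots \<Phi> \<xi> \<Longrightarrow> b + c \<in> pos_roots \<Phi> \<xi> \<Longrightarrow> Q b \<Longrightarrow> Q c \<Longrightarrow> Q (b + c)"
  shows "Q b"
  using assms(1)
\<comment> \<open>Heights \<open>b \<bullet> \<xi>\<close> are real, so the induction runs on the
  number of positive roots of smaller height.\<close>
proof (induction "card {c \<in> pos_roots \<Phi> \<xi>. c \<bullet> \<xi> < b \<bullet> \<xi>}" arbitrary: b rule: less_induct)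
  case less
  show ?case
  proof (cases "b \<in> simple_roots \<Phi> \<xi>")
    case False
    then obtain c d where cd: "c \<in> pos_roots \<Phi> \<xi>" "d \<in> pos_roots \<Phi> \<xi>" "b = c + d"
      using less.prems by (auto simp: simple_roots_def)
    have "Q e" if "e \<in> {c, d}" for e
    proof -
      have e: "e \<in> pos_roots \<Phi> \<xi>" "e \<bullet> \<xi> < b \<bullet> \<xi>"
        using that cd by (auto simp: pos_roots_def inner_add_left)
      then have "{c \<in> pos_roots \<Phi> \<xi>. c \<bullet> \<xi> < e \<bullet> \<xi>} \<subset> {c \<in> pos_roots \<Phi> \<xi>. c \<bullet> \<xi> < b \<bullet> \<xi>}"
        by force
      then show ?thesis
        using less.hyps[of e] e(1) finite_pos_roots by (simp add: psubset_card_mono)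
    qed
    then show ?thesis using cd assms(3) less.prems by auto
  qed (rule assms(2))
qed

lemma descent_simple:
  assumes "linear w" "b \<in> pos_roots \<Phi> \<xi>" "w b \<bullet> \<xi> < 0"
  shows "\<exists>a\<in>simple_roots \<Phi> \<xi>. w a \<bullet> \<xi> < 0"
  using assms(2,3)
proof (induction rule: pos_root_induct)
  case (sum b c)
  then have "w b \<bullet> \<xi> + w c \<bullet> \<xi> < 0" by (simp add: linear_add[OF assms(1)] inner_add_left)
  then have "w b \<bullet> \<xi> < 0 \<or> w c \<bullet> \<xi> < 0" by linarith
  then show ?case using sum.IH by blast
qed blast

text \<open>Otherwise \<open>b\<close> would pair nonpositively with all sums of simple roots, hence
  with itself.\<close>

lemma exists_simple_acute:
  assumes "b \<in> pos_roots \<Phi> \<xi>"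
  shows "\<exists>a\<in>simple_roots \<Phi> \<xi>. b \<bullet> a > 0"
proof (rule ccontr)
  assume *: "\<not> ?thesis"
  have "b \<bullet> c \<le> 0" if "c \<in> pos_roots \<Phi> \<xi>" for c
    using that by (induction rule: pos_root_induct) (use * in \<open>force simp: inner_add_right\<close>)+
  then have "b \<bullet> b \<le> 0" using assms by blast
  then have "b = 0" using inner_gt_zero_iff[of b] by linarith
  then show False using assms zero_notin_roots by (auto simp: pos_roots_def)
qed

text \<open>Reflecting \<open>b\<close> in a simple root at an acute angle gives a positive root
  \<open>c\<close> of smaller height, and \<open>refl b\<close> is conjugate to
  \<open>refl c\<close> by that simple reflection. This links \<open>weyl\<close>, which allows all
  reflections, to \<open>wlen\<close>, which counts simple ones.\<close>

lemma refl_simple_word: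
  assumes "b \<in> pos_roots \<Phi> \<xi>"
  shows "\<exists>ls. set ls \<subseteq> simple_roots \<Phi> \<xi> \<and> refl b = prod_refl ls"
  using assms
proof (induction "card {c \<in> pos_roots \<Phi> \<xi>. c \<bullet> \<xi> < b \<bullet> \<xi>}" arbitrary: b rule: less_induct)
  case less
  show ?case
  proof (cases "b \<in> simple_roots \<Phi> \<xi>")
    case True
    then show ?thesis by (intro exI[of _ "[b]"]) auto
  next
    case False
    obtain a where a: "a \<in> simple_roots \<Phi> \<xi>" "b \<bullet> a > 0" using exists_simple_acute[OF less.prems] by blast
    have aP: "a \<in> pos_roots \<Phi> \<xi>" using a simple_roots_pos by blast
    define c where "c = refl a b"
    have c: "c \<in> pos_roots \<Phi> \<xi>" using simple_refl_pos[OF a(1) less.prems] a False by (auto simp: c_def)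
    have "a \<noteq> 0" using a by auto
    then have "b \<bullet> coroot a > 0" using a by (simp add: coroot_def)
    then have "c \<bullet> \<xi> < b \<bullet> \<xi>" using aP by (simp add: c_def refl_def inner_diff_left pos_roots_def)
    then have "{d \<in> pos_roots \<Phi> \<xi>. d \<bullet> \<xi> < c \<bullet> \<xi>} \<subset> {d \<in> pos_roots \<Phi> \<xi>. d \<bullet> \<xi> < b \<bullet> \<xi>}"
      using c by force
    then have "card {d \<in> pos_roots \<Phi> \<xi>. d \<bullet> \<xi> < c \<bullet> \<xi>} < card {d \<in> pos_roots \<Phi> \<xi>. d \<bullet> \<xi> < b \<bullet> \<xi>}"
      using finite_pos_roots by (simp add: psubset_card_mono)
    then obtain ls where ls: "set ls \<subseteq> simple_roots \<Phi> \<xi>" "refl c = prod_refl ls"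
      using less.hyps[of c] c by blast
    have "refl b v = refl a (refl c (refl a v))" for v
      using refl_isometry[OF linear_refl, of a c "refl a v"] by (simp add: c_def)
    then have "refl b = prod_refl (a # ls @ [a])" by (auto simp flip: ls(2))
    then show ?thesis using ls a by (intro exI[of _ "a # ls @ [a]"]) auto
  qed
qed

lemma weyl_simple_word:
  assumes "w \<in> weyl \<Phi>"
  shows "\<exists>ls. set ls \<subseteq> simple_roots \<Phi> \<xi> \<and> w = prod_refl ls"
proof -
  have "set ls \<subseteq> \<Phi> \<Longrightarrow> \<exists>ls'. set ls' \<subseteq> simple_roots \<Phi> \<xi> \<and> prod_refl ls = prod_refl ls'" for ls
  proof (induction ls)
    case Nil
    then show ?case by (intro exI[of _ "[]"]) auto
  next
    case (Cons a ls)
    obtain ls' where ls': "set ls' \<subseteq> simple_roots \<Phi> \<xi>" "prod_refl ls = prod_refl ls'"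
      using Cons by auto
    obtain ls'' where "set ls'' \<subseteq> simple_roots \<Phi> \<xi>" "refl a = prod_refl ls''"
      using pos_or_neg[of a] Cons.prems refl_simple_word[of a] refl_simple_word[of "-a"] by auto
    then show ?case using ls' by (intro exI[of _ "ls'' @ ls'"]) auto
  qed
  then show ?thesis using assms by (auto simp: weyl_def)
qed

text \<open>At the letter where the image of \<open>a\<close> turns negative, that image is the
  letter itself, because a simple reflection makes only its own positive root negative. Conjugation
  then deletes this letter.\<close>

lemma exchange:
  assumes "set ls \<subseteq> simple_roots \<Phi> \<xi>" "a \<in> simple_roots \<Phi> \<xi>" "prod_refl ls a \<bullet> \<xi> < 0"
  shows "\<exists>ls'. set ls' \<subseteq> simple_roots \<Phi> \<xi> \<and> length ls = Suc (length ls') \<and> prod_refl ls' = prod_refl ls \<circ> refl a"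
  using assms(1,3)
proof (induction ls)
  case Nil
  then show ?case using assms(2) by (auto simp: simple_roots_def pos_roots_def)
next
  case (Cons b ls)
  let ?P = "prod_refl ls"
  have P: "?P \<in> weyl \<Phi>" using Cons.prems simple_roots_subset by (auto simp: weyl_def)
  show ?case
  proof (cases "?P a \<bullet> \<xi> < 0")
    case True
    then obtain ls' where "set ls' \<subseteq> simple_roots \<Phi> \<xi>" "length ls = Suc (length ls')" "prod_refl ls' = ?P \<circ> refl a"
      using Cons by (metis list.set_intros(2) subset_code(1))
    then show ?thesis using Cons.prems by (intro exI[of _ "b # ls'"]) (auto simp: comp_assoc)
  next
    case False
    have "?P a \<in> \<Phi>" using P assms(2) simple_roots_subset weyl_root by blast
    then have "?P a \<in> pos_roots \<Phi> \<xi>" using False regular[of "?P a"] by (auto simp: pos_roots_def)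
    moreover have "refl b (?P a) \<notin> pos_roots \<Phi> \<xi>" using Cons.prems by (auto simp: pos_roots_def)
    ultimately have eq: "?P a = b" using simple_refl_pos[of b "?P a"] Cons.prems by auto
    have "refl b (?P (refl a v)) = ?P v" for v
      using weyl_refl_conj[OF P, of a "refl a v"] by (simp add: eq)
    then show ?thesis using Cons.prems by (intro exI[of _ ls]) auto
  qed
qed

text \<open>Away from \<open>a\<close> the simple reflection permutes the positive roots, so it
  matches the inversions of \<open>w \<circ> refl a\<close> with those of \<open>w\<close> other
  than \<open>a\<close>.\<close>

lemma inversions_simple:
  assumes "a \<in> simple_roots \<Phi> \<xi>" "w \<in> weyl \<Phi>" "w a \<bullet> \<xi> < 0"
  shows "card (inversions w) = Suc (card (inversions (w \<circ> refl a)))"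
proof -
  have a: "a \<in> pos_roots \<Phi> \<xi>" "a \<in> \<Phi>" using assms(1) simple_roots_pos simple_roots_subset by auto
  have wa: "(w \<circ> refl a) a \<bullet> \<xi> > 0" using assms(3) by (simp add: linear_neg[OF weyl_linear[OF assms(2)]])
  have *: "refl a b \<in> inversions w - {a}" if "b \<in> inversions (w \<circ> refl a)" for b
  proof -
    have "b \<noteq> a" using that wa by auto
    moreover have "refl a b \<noteq> a"
    proof
      assume "refl a b = a"
      then have "b = - a" by (metis refl_refl refl_self)
      then show False using that a by (simp add: pos_roots_def)
    qed
    ultimately show ?thesis using that simple_refl_pos[OF assms(1), of b] by auto
  qed
  have **: "refl a b \<in> inversions (w \<circ> refl a)" if "b \<in> inversions w - {a}" for b
    using that simple_refl_pos[OF assms(1), of b] by auto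
  have "bij_betw (refl a) (inversions (w \<circ> refl a)) (inversions w - {a})"
    by (rule bij_betw_byWitness[of _ "refl a"]) (use * ** in auto)
  then have "card (inversions (w \<circ> refl a)) = card (inversions w - {a})" by (rule bij_betw_same_card)
  moreover have "a \<in> inversions w" using a assms by auto
  ultimately show ?thesis using card_Suc_Diff1[of "inversions w" a] by (simp del: card_Diff_insert)
qed

lemma card_inversions_word:
  assumes "set ls \<subseteq> simple_roots \<Phi> \<xi>"
  shows "card (inversions (prod_refl ls)) \<le> length ls"
  using assms
proof (induction ls rule: rev_induct)
  case Nil
  have "inversions id = {}" by (auto simp: pos_roots_def)
  then show ?case by simp
next
  case (snoc a ls)
  let ?w = "prod_refl ls"
  have a: "a \<in> simple_roots \<Phi> \<xi>" "a \<in> \<Phi>" using snoc.prems simple_roots_subset by auto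
  have w: "?w \<in> weyl \<Phi>" using snoc.prems simple_roots_subset by (auto simp: weyl_def)
  show ?case
  proof (cases "?w a \<bullet> \<xi> < 0")
    case True
    then show ?thesis using inversions_simple[OF a(1) w] snoc by simp
  next
    case False
    then have "?w a \<bullet> \<xi> > 0" using regular[OF weyl_root[OF w a(2)]] by auto
    then have "(?w \<circ> refl a) a \<bullet> \<xi> < 0" by (simp add: linear_neg[OF linear_prod_refl])
    then have "card (inversions (?w \<circ> refl a)) = Suc (card (inversions (?w \<circ> refl a \<circ> refl a)))"
      using inversions_simple[OF a(1), of "?w \<circ> refl a"] w a(2) by simp
    then show ?thesis using snoc by (simp add: comp_assoc)
  qed
qed

lemma word_of_card_inversions:
  assumes "w \<in> weyl \<Phi>"
  shows "\<exists>ls. set ls \<subseteq> simple_roots \<Phi> \<xi> \<and> w = prod_refl ls \<and> length ls = card (inversions w)"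
  using assms
proof (induction "card (inversions w)" arbitrary: w)
  case 0
  then have inv0: "inversions w = {}" using card_0_eq[OF finite_inversions, of w] by presburger
  define Q where "Q ls \<longleftrightarrow> set ls \<subseteq> simple_roots \<Phi> \<xi> \<and> w = prod_refl ls" for ls
  obtain ls where ls: "Q ls" "\<And>ls'. Q ls' \<Longrightarrow> length ls \<le> length ls'"
    using weyl_simple_word[OF "0.prems"] ex_has_least_nat[of Q _ length] Q_def by metis
  \<comment> \<open>A shortest word of an element without inversions is empty:
    \<open>exchange\<close> at the last letter would give a word shorter by two.\<close>
  have "ls = []"
  proof (rule ccontr)
    assume "ls \<noteq> []"
    then obtain ls1 a where eq: "ls = ls1 @ [a]" by (metis rev_exhaust)
    have a: "a \<in> simple_roots \<Phi> \<xi>" "set ls1 \<subseteq> simple_roots \<Phi> \<xi>" using ls eq by (auto simp: Q_def)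
    have w: "w = prod_refl ls1 \<circ> refl a" using ls eq by (auto simp: Q_def)
    have "w a \<bullet> \<xi> > 0"
      using inv0 a(1) simple_roots_pos simple_roots_subset regular[OF weyl_root[OF "0.prems"], of a]
      by (smt (verit, best) empty_iff mem_Collect_eq subsetD)
    then have "prod_refl ls1 a \<bullet> \<xi> < 0" using w by (simp add: linear_neg[OF linear_prod_refl])
    then obtain ls' where "set ls' \<subseteq> simple_roots \<Phi> \<xi>" "length ls1 = Suc (length ls')" "prod_refl ls' = w"
      using exchange[OF a(2,1)] w by metis
    then show False using ls(2)[of ls'] eq by (simp add: Q_def)
  qed
  then show ?case using ls(1) "0.hyps" by (intro exI[of _ "[]"]) (simp add: Q_def)
next
  case (Suc n)
  then have "inversions w \<noteq> {}" by (metis card.empty nat.distinct(1))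
  then obtain a where a: "a \<in> simple_roots \<Phi> \<xi>" "w a \<bullet> \<xi> < 0"
    using descent_simple[OF weyl_linear[OF Suc.prems]] by blast
  then have "card (inversions (w \<circ> refl a)) = n" using inversions_simple[OF a(1) Suc.prems a(2)] Suc by simp
  moreover have "w \<circ> refl a \<in> weyl \<Phi>" using Suc.prems a simple_roots_subset by auto
  ultimately obtain ls where ls: "set ls \<subseteq> simple_roots \<Phi> \<xi>" "w \<circ> refl a = prod_refl ls" "length ls = n"
    using Suc.hyps(1)[of "w \<circ> refl a"] by metis
  have "w = prod_refl (ls @ [a])" by (simp flip: ls(2))
  then show ?case using ls a Suc.hyps(2) by (intro exI[of _ "ls @ [a]"]) auto
qed

text \<open>Replaces a minimum over words by a count of roots, which can be split along a rank 2
  subsystem.\<close>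

lemma wlen_inversions:
  assumes "w \<in> weyl \<Phi>"
  shows "wlen \<Phi> \<xi> w = card (inversions w)"
  unfolding wlen_def
proof (rule Least_equality)
  show "\<exists>ls. length ls = card (inversions w) \<and> set ls \<subseteq> simple_roots \<Phi> \<xi> \<and> w = prod_refl ls"
    using word_of_card_inversions[OF assms] by blast
  show "card (inversions w) \<le> n"
    if "\<exists>ls. length ls = n \<and> set ls \<subseteq> simple_roots \<Phi> \<xi> \<and> w = prod_refl ls" for n
    using that card_inversions_word by blast
qed

text \<open>The injection sends \<open>c\<close> to \<open>refl b c\<close> if this is positive and
  fixes \<open>c\<close> otherwise; in the second case \<open>w c\<close> is
  \<open>w (refl b c)\<close> plus a positive multiple of \<open>w b\<close>, both negative against
  \<open>\<xi>\<close>. Stability of \<open>P\<close> is asked only where the reflected root is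
  positive, so that the positive roots outside a rank 2 system qualify.\<close>

lemma card_inversions_refl_le:
  assumes P: "P \<subseteq> pos_roots \<Phi> \<xi>" and b: "b \<in> pos_roots \<Phi> \<xi>"
    and stable: "\<And>c. c \<in> P \<Longrightarrow> refl b c \<in> pos_roots \<Phi> \<xi> \<Longrightarrow> refl b c \<in> P"
    and w: "w \<in> weyl \<Phi>" "w b \<bullet> \<xi> < 0"
  shows "card {c \<in> P. (w \<circ> refl b) c \<bullet> \<xi> < 0} \<le> card {c \<in> P. w c \<bullet> \<xi> < 0}"
proof (rule card_inj_on_le)
  let ?f = "\<lambda>c. if refl b c \<in> pos_roots \<Phi> \<xi> then refl b c else c"
  show "inj_on ?f {c \<in> P. (w \<circ> refl b) c \<bullet> \<xi> < 0}"
    using P by (intro inj_onI) (auto split: if_splits dest: arg_cong[where f = "refl b"])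
  show "?f ` {c \<in> P. (w \<circ> refl b) c \<bullet> \<xi> < 0} \<subseteq> {c \<in> P. w c \<bullet> \<xi> < 0}"
  proof (rule image_subsetI)
    fix c assume "c \<in> {c \<in> P. (w \<circ> refl b) c \<bullet> \<xi> < 0}"
    then have c: "c \<in> P" "w (refl b c) \<bullet> \<xi> < 0" "c \<in> pos_roots \<Phi> \<xi>" using P by auto
    show "?f c \<in> {c \<in> P. w c \<bullet> \<xi> < 0}"
    proof (cases "refl b c \<in> pos_roots \<Phi> \<xi>")
      case True
      then show ?thesis using c stable by auto
    next
      case False
      note d = pos_root_diff(1)[OF b c(3) False]
      have "w c = w (refl b c) + (c \<bullet> coroot b) *\<^sub>R w b"
        by (simp add: refl_def linear_diff[OF weyl_linear[OF w(1)]] linear_scale[OF weyl_linear[OF w(1)]])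
      then have "w c \<bullet> \<xi> = w (refl b c) \<bullet> \<xi> + (c \<bullet> coroot b) * (w b \<bullet> \<xi>)" by (simp add: inner_add_left)
      moreover have "(c \<bullet> coroot b) * (w b \<bullet> \<xi>) < 0" using d w(2) by (simp add: mult_pos_neg)
      ultimately show ?thesis using False c by simp
    qed
  qed
  show "finite {c \<in> P. w c \<bullet> \<xi> < 0}" using finite_subset[OF P finite_pos_roots] by simp
qed

text \<open>On coordinate functions the operator pulls back: the coefficient at \<open>u\<close>
  comes from the single element \<open>u \<circ> refl a\<close>, which has to be longer.\<close>

lemma Bpos_eval:
  assumes "a \<in> \<Phi>"
  shows "Bpos \<Phi> \<xi> a f u =
    (if u \<in> weyl \<Phi> \<and> wlen \<Phi> \<xi> (u \<circ> refl a) = wlen \<Phi> \<xi> u + 1 then f (u \<circ> refl a) else 0)"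
proof -
  have iff: "w \<circ> refl a = u \<longleftrightarrow> w = u \<circ> refl a" for w
    using refl_comp_refl_left by metis
  have "Bpos \<Phi> \<xi> a f u = (\<Sum>w\<in>weyl \<Phi>. if w = u \<circ> refl a then
      (if wlen \<Phi> \<xi> (u \<circ> refl a) = wlen \<Phi> \<xi> u + 1 then f (u \<circ> refl a) else 0) else 0)"
    unfolding Bpos_def by (rule sum.cong) (auto simp: iff)
  also have "\<dots> = (if u \<in> weyl \<Phi> \<and> wlen \<Phi> \<xi> (u \<circ> refl a) = wlen \<Phi> \<xi> u + 1 then f (u \<circ> refl a) else 0)"
    using assms by (simp add: sum.delta' sum.delta finite_weyl)
  finally show ?thesis .
qed

end

section \<open>Paths in a dihedral coset\<close>

text \<open>A coset of a dihedral group of order \<open>2 * m\<close> is modelled by the integers modulo \<open>2 * m\<close>: right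
  multiplication by the \<open>i\<close>-th reflection is \<open>p \<mapsto> 2 * i - 1 - p\<close>, \<open>E\<close> is the length in the ambient
  Weyl group, and \<open>\<bar>p\<bar>\<close> for \<open>\<bar>p\<bar> \<le> m\<close> is the length in the dihedral group.\<close>

definition yb_step :: "(int \<Rightarrow> int) \<Rightarrow> int \<Rightarrow> (int \<Rightarrow> 'r::ab_group_add) \<Rightarrow> int \<Rightarrow> 'r" where
  "yb_step E i F p = F p + (if E (2*i-1-p) = E p + 1 then F (2*i-1-p) else 0)"

text \<open>Odd \<open>p + q\<close> says that the two coset elements differ by one reflection.
  \<open>E_grows\<close> is only an inequality because roots outside the rank 2 system may
  contribute to the length as well.\<close>

locale dihedral_heights =
  fixes m :: int and E :: "int \<Rightarrow> int"
  assumes m_pos: "m \<ge> 1"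
    and E_period: "E (p + 2*m) = E p"
    and E_grows: "\<bar>p\<bar> < \<bar>q\<bar> \<Longrightarrow> \<bar>q\<bar> \<le> m \<Longrightarrow> odd (p + q) \<Longrightarrow> E q - E p \<ge> \<bar>q\<bar> - \<bar>p\<bar>"
begin

lemma E_period': "E (p - 2*m) = E p"
  using E_period[of "p - 2*m"] by simp

text \<open>\<open>E\<close> grows at least as fast as the level, so a difference of one leaves room
  for one level only: coverings in W inside the coset are coverings of the dihedral group.\<close>

lemma cover_level:
  assumes "E q = E p + 1" "\<bar>p\<bar> \<le> m" "\<bar>q\<bar> \<le> m" "odd (p + q)"
  shows "\<bar>q\<bar> = \<bar>p\<bar> + 1"
proof -
  have "\<bar>q\<bar> \<noteq> \<bar>p\<bar>" using assms(4) by (auto simp: abs_eq_iff)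
  then consider "\<bar>p\<bar> < \<bar>q\<bar>" | "\<bar>q\<bar> < \<bar>p\<bar>" by linarith
  then show ?thesis
  proof cases
    case 1
    then show ?thesis using E_grows[of p q] assms by linarith
  next
    case 2
    then show ?thesis using E_grows[of q p] assms by (simp add: add.commute)
  qed
qed

definition cov :: "int \<Rightarrow> int \<Rightarrow> 'r \<Rightarrow> 'r::ab_group_add" where
  "cov p q x = (if E q = E p + 1 then x else 0)"

lemma cov_add: "cov p q (x + y) = cov p q x + cov p q y"
  by (simp add: cov_def)

lemma cov_diff: "cov p q (x - y) = cov p q x - cov p q y"
  by (simp add: cov_def)

text \<open>Both sides are nonzero only if \<open>E x = E p + 2\<close>, and then both intermediate steps are coverings.\<close>
lemma cov_cov:
  assumes "\<bar>y\<bar> = \<bar>p\<bar> + 1" "\<bar>z\<bar> = \<bar>p\<bar> + 1" "\<bar>x\<bar> = \<bar>p\<bar> + 2" "\<bar>x\<bar> \<le> m"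
  shows "cov p y (cov y x f) = cov p z (cov z x f)"
proof -
  have par: "odd (p + y)" "odd (p + z)" "odd (y + x)" "odd (z + x)"
    using assms by presburger+
  have "E y \<ge> E p + 1" "E z \<ge> E p + 1" "E x \<ge> E y + 1" "E x \<ge> E z + 1"
    using E_grows[of p y] E_grows[of p z] E_grows[of y x] E_grows[of z x] assms par by auto
  then show ?thesis by (auto simp: cov_def)
qed

definition periodic :: "(int \<Rightarrow> 'r) \<Rightarrow> bool" where
  "periodic F \<longleftrightarrow> (\<forall>p. F (p + 2*m) = F p)"

lemma periodicD: "periodic F \<Longrightarrow> F (p - 2*m) = F p"
  unfolding periodic_def by (metis diff_add_cancel)

lemma periodic_step: "periodic F \<Longrightarrow> periodic (yb_step E i F)"
  unfolding periodic_def
proof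
  fix p assume F: "\<forall>p. F (p + 2*m) = F p"
  have "E (2*i-1-(p+2*m)) = E (2*i-1-p)" using E_period'[of "2*i-1-p"] by (simp add: algebra_simps)
  moreover have "F (2*i-1-(p+2*m)) = F (2*i-1-p)" using F[rule_format, of "2*i-1-(p+2*m)"] by (simp add: algebra_simps)
  ultimately show "yb_step E i F (p + 2*m) = yb_step E i F p"
    by (simp add: yb_step_def E_period F)
qed

lemma periodic_foldr: "periodic F \<Longrightarrow> periodic (foldr (yb_step E) is F)"
  by (induction "is") (auto simp: periodic_step)

text \<open>Reducing the target \<open>2 * i - 1 - p\<close> of a step modulo \<open>2 * m\<close> into \<open>[-m, m]\<close>.\<close>
lemma step_reduced:
  assumes "periodic F" "1 \<le> i" "i \<le> m" "\<bar>p\<bar> \<le> m"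
  obtains q where "q = 2*i-1-p \<or> q = 2*i-1-p-2*m" "\<bar>q\<bar> \<le> m" "odd (p + q)"
    "yb_step E i F p = F p + cov p q (F q)"
proof -
  define q where "q = (if 2*i-1-p \<le> m then 2*i-1-p else 2*i-1-p-2*m)"
  have "E q = E (2*i-1-p)" "F q = F (2*i-1-p)"
    using E_period'[of "2*i-1-p"] periodicD[OF assms(1), of "2*i-1-p"] by (auto simp: q_def)
  then have "yb_step E i F p = F p + cov p q (F q)" by (simp add: yb_step_def cov_def)
  moreover have "\<bar>q\<bar> \<le> m" "odd (p + q)" using assms by (auto simp: q_def)
  ultimately show ?thesis using that[of q] by (auto simp: q_def)
qed

lemma step_top:
  assumes "periodic F" "1 \<le> i" "i \<le> m" "\<bar>p\<bar> = m"
  shows "yb_step E i F p = F p"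
proof -
  obtain q where q: "\<bar>q\<bar> \<le> m" "odd (p + q)" "yb_step E i F p = F p + cov p q (F q)"
    using step_reduced[OF assms(1-3), of p] assms(4) by auto
  then show ?thesis using cover_level[of q p] assms(4) by (auto simp: cov_def)
qed

text \<open>Only targets on level \<open>q + 1\<close> matter, and solving
  \<open>2*i - 1 - q = \<plusminus>(q + 1)\<close> modulo \<open>2*m\<close> leaves the labels
  \<open>q + 1\<close> and \<open>m\<close>. If these coincide, \<open>q + 1\<close> and
  \<open>-(q+1)\<close> name the same top element, hence the exclusive cases.\<close>

lemma step_pos:
  assumes "periodic F" "1 \<le> i" "i \<le> m" "0 \<le> q" "q < m"
  shows "yb_step E i F q = F q + (if i = q + 1 then cov q (q+1) (F (q+1))
           else if i = m then cov q (-(q+1)) (F (-(q+1))) else 0)"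
proof -
  obtain r where r: "r = 2*i-1-q \<or> r = 2*i-1-q-2*m" "\<bar>r\<bar> \<le> m" "odd (q + r)"
      "yb_step E i F q = F q + cov q r (F r)"
    using step_reduced[OF assms(1-3), of q] assms(4,5) by auto
  show ?thesis
  proof (cases "\<bar>r\<bar> = q + 1")
    case False
    then have "cov q r (F r) = 0" using cover_level[of r q] r assms by (auto simp: cov_def)
    moreover have "i \<noteq> q + 1 \<or> r = 2*i-1-q-2*m" "i \<noteq> m \<or> r = 2*i-1-q" using False r(1) assms by auto
    ultimately show ?thesis using r False assms by auto
  next
    case True
    then consider "r = q + 1" | "r = -(q+1)" by linarith
    then show ?thesis
    proof cases
      case 1
      then have "i = q + 1" using r(1) assms by auto
      then show ?thesis using r(4) 1 by simp
    next
      case 2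
      then have "i = m" using r(1) assms by auto
      then show ?thesis using r(4) 2 periodicD[OF assms(1), of "q+1"] E_period'[of "q+1"]
        by (auto simp: cov_def)
    qed
  qed
qed

text \<open>The same congruence starting from \<open>-q\<close> leaves the labels \<open>1\<close>
  and \<open>m - q\<close>.\<close>

lemma step_neg:
  assumes "periodic F" "1 \<le> i" "i \<le> m" "0 \<le> q" "q < m"
  shows "yb_step E i F (-q) = F (-q) + (if i = 1 then cov (-q) (q+1) (F (q+1))
           else if i = m - q then cov (-q) (-(q+1)) (F (-(q+1))) else 0)"
proof -
  obtain r where r: "r = 2*i-1+q \<or> r = 2*i-1+q-2*m" "\<bar>r\<bar> \<le> m" "odd (-q + r)"
      "yb_step E i F (-q) = F (-q) + cov (-q) r (F r)"
    using step_reduced[OF assms(1-3), of "-q"] assms(4,5) by auto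
  show ?thesis
  proof (cases "\<bar>r\<bar> = q + 1")
    case False
    then have "cov (-q) r (F r) = 0" using cover_level[of r "-q"] r assms by (auto simp: cov_def)
    then show ?thesis using r False assms by auto
  next
    case True
    then consider "r = q + 1" | "r = -(q+1)" by linarith
    then show ?thesis
    proof cases
      case 1
      then have "i = 1" using r(1) assms by auto
      then show ?thesis using r(4) 1 by simp
    next
      case 2
      then have i: "i = m - q" using r(1) assms by auto
      show ?thesis
      proof (cases "i = 1")
        case True
        then have "q + 1 - 2*m = r" using i 2 by simp
        then have "F (q+1) = F r" "E (q+1) = E r"
          using periodicD[OF assms(1), of "q+1"] E_period'[of "q+1"] by simp_all
        then show ?thesis using True r(4) by (simp add: cov_def)
      next
        case False
        then show ?thesis using i r(4) 2 by simp
      qed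
    qed
  qed
qed

context
  fixes F :: "int \<Rightarrow> 'r::ab_group_add"
  assumes F: "periodic F"
begin

text \<open>\<open>S j\<close> collects the ascending paths whose labels increase and are at least \<open>j\<close>. From level \<open>q\<close> such a path
  either keeps its sign, with labels \<open>q + 1, q + 2, \<dots>\<close> on the positive side, or changes sign once, by
  label \<open>m\<close> from the positive and by label \<open>1\<close> from the negative side.\<close>
definition S :: "int \<Rightarrow> int \<Rightarrow> 'r" where
  "S j = foldr (yb_step E) [j..m] F"

lemma periodic_S: "periodic (S j)"
  by (simp add: S_def periodic_foldr F)

lemma S_end: "j > m \<Longrightarrow> S j = F"
  by (simp add: S_def)

lemma S_rec: "j \<le> m \<Longrightarrow> S j = yb_step E j (S (j+1))"
  by (simp add: S_def upto_rec1)

lemma S_top: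
  assumes "j \<ge> 1" "\<bar>p\<bar> = m"
  shows "S j p = F p"
proof (cases "j \<le> m + 1")
  case True
  then show ?thesis using assms
    by (induction j rule: int_le_induct) (auto simp: S_end S_rec step_top periodic_S)
next
  case False
  then show ?thesis by (simp add: S_end)
qed

text \<open>Once label \<open>q + 1\<close> is passed, only \<open>m\<close> leads upwards from
  \<open>q\<close>; being the last label, it ends the path.\<close>

lemma S_pos_high:
  assumes "0 \<le> q" "q + 1 < j" "j \<le> m"
  shows "S j q = F q + cov q (-(q+1)) (F (-(q+1)))"
  using assms(3,2)
proof (induction j rule: int_le_induct)
  case base
  then show ?case using assms(1) by (simp add: S_rec S_end step_pos F)
next
  case (step j)
  then show ?case using assms(1) by (simp add: S_rec[of "j - 1"] step_pos periodic_S)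
qed

lemma S_pos_low:
  assumes "1 \<le> j" "j \<le> q + 1" "q \<le> m"
  shows "S j q = S (q+1) q"
  using assms(2,1)
proof (induction j rule: int_le_induct)
  case base
  then show ?case by simp
next
  case (step j)
  then have "S (j - 1) q = S j q" using assms(3)
    by (cases "q = m") (simp_all add: S_rec[of "j - 1"] step_top step_pos periodic_S)
  then show ?case using step by simp
qed

lemma S_pos:
  assumes "0 \<le> q" "q + 1 < m"
  shows "S 1 q = F q + cov q (-(q+1)) (F (-(q+1))) + cov q (q+1) (S 1 (q+1))"
proof -
  have "S (q+1) q = S (q+2) q + cov q (q+1) (S (q+2) (q+1))"
    using assms step_pos[OF periodic_S, of "q+1" q "q+2"] S_rec[of "q+1"] by (simp add: add.commute[of 2 q])
  then show ?thesis
    using S_pos_high[of q "q+2"] S_pos_low[of 1 q] S_pos_low[of 1 "q+1"] assms by (simp add: add.commute)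
qed

text \<open>Both labels leading upwards from \<open>-q\<close>, namely \<open>1\<close> and
  \<open>m - q\<close>, are already passed.\<close>

lemma S_neg_high:
  assumes "0 \<le> q" "q \<le> m" "m - q < j" "1 < j" "j \<le> m + 1"
  shows "S j (-q) = F (-q)"
  using assms(5,3,4)
proof (induction j rule: int_le_induct)
  case base
  then show ?case by (simp add: S_end)
next
  case (step j)
  then show ?case using assms(1,2)
    by (cases "q = m") (simp_all add: S_rec[of "j - 1"] step_top step_neg periodic_S)
qed

text \<open>After the step with label \<open>m - q\<close> the path is stuck: from
  \<open>-(q+1)\<close> it would need \<open>1\<close> or the smaller label
  \<open>m - q - 1\<close>.\<close>

lemma S_neg_low:
  assumes "0 \<le> q" "1 < j" "j \<le> m - q"
  shows "S j (-q) = F (-q) + cov (-q) (-(q+1)) (F (-(q+1)))"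
  using assms(3,2)
proof (induction j rule: int_le_induct)
  case base
  have "S (m - q + 1) (-(q+1)) = F (-(q+1))" "S (m - q + 1) (-q) = F (-q)"
    using S_neg_high[of "q+1" "m-q+1"] S_neg_high[of q "m-q+1"] assms base by auto
  then show ?case using assms(1) base by (simp add: S_rec[of "m - q"] step_neg periodic_S)
next
  case (step j)
  then show ?case using assms(1) by (simp add: S_rec[of "j - 1"] step_neg periodic_S)
qed

lemma S_neg:
  assumes "0 \<le> q" "q + 1 < m"
  shows "S 1 (-q) = F (-q) + cov (-q) (-(q+1)) (F (-(q+1))) + cov (-q) (q+1) (S 1 (q+1))"
proof -
  have "S 1 (-q) = S 2 (-q) + cov (-q) (q+1) (S 2 (q+1))"
    using assms by (simp add: S_rec[of 1] step_neg periodic_S)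
  then show ?thesis
    using S_neg_low[of q 2] S_pos_low[of 1 "q+1"] S_pos_low[of 2 "q+1"] assms by simp
qed

lemma S_pos_last: "S 1 (m - 1) = F (m - 1) + cov (m - 1) m (F m)"
  using S_pos_low[of 1 "m - 1"] m_pos by (simp add: S_rec[of m] S_end step_pos F)

lemma S_neg_last: "S 1 (-(m - 1)) = F (-(m - 1)) + cov (-(m - 1)) m (F m)"
proof -
  have "S 1 (-(m-1)) = S 2 (-(m-1)) + cov (-(m-1)) m (S 2 m)"
    using m_pos step_neg[OF periodic_S, of 1 "m-1" 2] by (simp add: S_rec[of 1])
  moreover have "S 2 (-(m-1)) = F (-(m-1))" using S_neg_high[of "m-1" 2] m_pos by simp
  ultimately show ?thesis using S_top[of 2 m] m_pos by simp
qed

end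

lemma reflected: "dihedral_heights m (\<lambda>p. E (- p))"
proof
  show "E (- (p + 2*m)) = E (- p)" for p using E_period'[of "-p"] by simp
  show "\<bar>p\<bar> < \<bar>q\<bar> \<Longrightarrow> \<bar>q\<bar> \<le> m \<Longrightarrow> odd (p + q) \<Longrightarrow> E (-q) - E (-p) \<ge> \<bar>q\<bar> - \<bar>p\<bar>" for p q
    using E_grows[of "-p" "-q"] by simp
qed (rule m_pos)

text \<open>Negating positions and reversing labels turns a decreasing product into an increasing
  one for the reflected height, so the path analysis of \<open>S\<close> serves both sides.\<close>

lemma foldr_reflected:
  assumes F: "periodic F"
  shows "foldr (yb_step E) (map (\<lambda>i. m + 1 - i) is) F p
    = foldr (yb_step (\<lambda>p. E (- p))) is (\<lambda>p. F (- p)) (- p)"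
proof (induction "is" arbitrary: p)
  case (Cons i "is")
  define G where "G = foldr (yb_step E) (map (\<lambda>i. m + 1 - i) is) F"
  define H where "H = foldr (yb_step (\<lambda>p. E (- p))) is (\<lambda>p. F (- p))"
  define q where "q = 2 * i - 1 + p"
  have q: "2 * (m + 1 - i) - 1 - p = - q + 2 * m" by (simp add: q_def)
  have G: "G (- q + 2 * m) = G (- q)"
    using periodic_foldr[OF F, of "map (\<lambda>i. m + 1 - i) is"] unfolding periodic_def G_def by blast
  have IH: "G p = H (- p)" for p using Cons by (simp add: G_def H_def)
  have "yb_step E (m + 1 - i) G p = yb_step (\<lambda>p. E (- p)) i H (- p)"
  proof -
    have "2 * i - 1 - (- p) = q" "- (- p) = p" by (simp_all add: q_def)
    then show ?thesis
      unfolding yb_step_def q G E_period by (simp only: IH minus_minus)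
  qed
  then show ?case by (simp add: G_def H_def)
qed simp

lemma rev_upto_map: "rev [1..m] = map (\<lambda>i. m + 1 - i) [1..m]"
proof (rule nth_equalityI)
  fix i assume "i < length (rev [1..m])"
  then have i: "i < nat m" by simp
  have "[1..m] ! (nat m - Suc i) = 1 + int (nat m - Suc i)" by (rule nth_upto) (use i in auto)
  moreover have "[1..m] ! i = 1 + int i" by (rule nth_upto) (use i in auto)
  ultimately show "rev [1..m] ! i = map (\<lambda>i. m + 1 - i) [1..m] ! i"
    using i by (simp add: rev_nth)
qed simp

text \<open>Downward induction on the level. On level \<open>q\<close> the increasing product
  \<open>A\<close> stops at \<open>-(q+1)\<close> and continues at \<open>q + 1\<close>, while the
  decreasing product \<open>A'\<close> does the opposite. With agreement on level
  \<open>q + 1\<close>, equality reduces to \<open>key\<close>.\<close>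

lemma yang_baxter_heights:
  fixes F :: "int \<Rightarrow> 'r::ab_group_add"
  assumes F: "periodic F" and p: "\<bar>p\<bar> \<le> m"
  shows "foldr (yb_step E) [1..m] F p = foldr (yb_step E) (rev [1..m]) F p"
proof -
  interpret r: dihedral_heights m "\<lambda>p. E (- p)" by (rule reflected)
  define G where "G p = F (- p)" for p
  have G: "r.periodic G"
    using periodicD[OF F, of "- p" for p] by (simp add: r.periodic_def G_def)
  define A where "A = S F 1"
  define A' where "A' p = r.S G 1 (- p)" for p
  have A': "foldr (yb_step E) (rev [1..m]) F = A'"
    by (rule ext) (simp add: rev_upto_map foldr_reflected[OF F] A'_def r.S_def[OF G] flip: G_def)
  have covr: "r.cov x y z = cov (-x) (-y) z" for x y and z :: 'r by (simp add: r.cov_def cov_def)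
  have main: "A q = A' q \<and> A (-q) = A' (-q)" if "0 \<le> q" "q \<le> m" for q
    using that(2,1)
  proof (induction q rule: int_le_induct)
    case base
    show ?case using S_top[OF F, of 1] r.S_top[OF G, of 1] m_pos by (simp add: A_def A'_def G_def)
  next
    case (step q')
    define q where "q = q' - 1"
    have q: "0 \<le> q" "q + 1 \<le> m" "q' = q + 1" using step by (auto simp: q_def)
    have IH: "A (q+1) = A' (q+1)" "A (-(q+1)) = A' (-(q+1))" using step q by auto
    show ?case
    proof (cases "q + 1 = m")
      case True
      then have [simp]: "q = m - 1" by simp
      have Fm: "F (-m) = F m" "E (-m) = E m" using periodicD[OF F, of m] E_period'[of m] by auto
      show ?thesis
        using S_pos_last[OF F] S_neg_last[OF F] r.S_pos_last[OF G] r.S_neg_last[OF G] Fm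
        by (simp add: A_def A'_def G_def covr cov_def flip: q_def)
    next
      case False
      then have q1: "q + 1 < m" using q by simp
      have A1: "A q = F q + cov q (-(q+1)) (F (-(q+1))) + cov q (q+1) (A (q+1))"
        and A2: "A (-q) = F (-q) + cov (-q) (-(q+1)) (F (-(q+1))) + cov (-q) (q+1) (A (q+1))"
        using S_pos[OF F q(1) q1] S_neg[OF F q(1) q1] by (simp_all add: A_def)
      have A'1: "A' (-q) = F (-q) + cov (-q) (q+1) (F (q+1)) + cov (-q) (-(q+1)) (A' (-(q+1)))"
        and A'2: "A' q = F q + cov q (q+1) (F (q+1)) + cov q (-(q+1)) (A' (-(q+1)))"
        using r.S_pos[OF G q(1) q1] r.S_neg[OF G q(1) q1]
        by (simp_all add: A'_def G_def covr add.commute[of 1 q])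
      \<comment> \<open>What \<open>A\<close> adds to \<open>F\<close> at \<open>q + 1\<close> and
        at \<open>-(q+1)\<close> passes to level \<open>q + 2\<close> with the same two end values,
        so \<open>cov_cov\<close> exchanges the intermediate element.\<close>
      have key: "cov p (q+1) (A (q+1) - F (q+1)) = cov p (-(q+1)) (A (-(q+1)) - F (-(q+1)))"
        if p: "\<bar>p\<bar> = q" for p
      proof (cases "q + 2 = m")
        case True
        \<comment> \<open>Here the level above is the single top element \<open>m\<close>, which is
          also \<open>-m\<close>, so there is one term instead of two.\<close>
        have Fm: "F (-m) = F m" "E (-m) = E m" using periodicD[OF F, of m] E_period'[of m] by auto
        have "m - 1 = q + 1" using True by simp
        then have "A (q+1) - F (q+1) = cov (q+1) m (F m)" "A (-(q+1)) - F (-(q+1)) = cov (-(q+1)) m (F m)"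
          using S_pos_last[OF F] S_neg_last[OF F] by (simp_all only: A_def add_diff_cancel_left')
        then show ?thesis using cov_cov[of "q+1" p "-(q+1)" m] p True q by simp
      next
        case False
        then have q2: "q + 1 + 1 < m" using q1 by simp
        have e: "q + 1 + 1 = q + 2" by simp
        have "A (q+1) - F (q+1) = cov (q+1) (-(q+2)) (F (-(q+2))) + cov (q+1) (q+2) (A (q+2))"
          "A (-(q+1)) - F (-(q+1)) = cov (-(q+1)) (-(q+2)) (F (-(q+2))) + cov (-(q+1)) (q+2) (A (q+2))"
          using S_pos[OF F _ q2] S_neg[OF F _ q2] q unfolding e by (simp_all add: A_def)
        then show ?thesis
          using cov_cov[of "q+1" p "-(q+1)" "q+2" "A (q+2)"]
            cov_cov[of "q+1" p "-(q+1)" "-(q+2)" "F (-(q+2))"] p q q2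
          by (simp only: cov_add)
      qed
      have "A p = A' p" if "p = q \<or> p = -q" for p
        using key[of p] that q A1 A2 A'1 A'2 IH by (auto simp: cov_diff algebra_simps)
      then show ?thesis using q by simp
    qed
  qed
  have "A p = A' p" using main[of "\<bar>p\<bar>"] p by (cases "p \<ge> 0") auto
  then show ?thesis by (simp add: A' A_def S_def[OF F])
qed

end

section \<open>Bruhat operators along a dihedral sequence of roots\<close>

context root_system
begin

lemma Bop_eval:
  assumes "a \<in> \<Phi>"
  shows "Bop \<Phi> \<xi> a f u =
    (if u \<in> weyl \<Phi> \<and> wlen \<Phi> \<xi> (u \<circ> refl a) = wlen \<Phi> \<xi> u + 1
     then (if a \<in> pos_roots \<Phi> \<xi> then f (u \<circ> refl a) else - f (u \<circ> refl a)) else 0)"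
  using assms by (simp add: Bop_def Bpos_eval)

lemma Bop_minus: "a \<in> \<Phi> \<Longrightarrow> Bop \<Phi> \<xi> (- a) f u = - Bop \<Phi> \<xi> a f u"
  using regular[of a] by (auto simp: Bop_eval pos_roots_def)

text \<open>The second step along the same reflection would return to the start while lengthening
  again. Hence \<open>1 - B_a\<close> inverts \<open>1 + B_a\<close>.\<close>

lemma Bop_Bop: "a \<in> \<Phi> \<Longrightarrow> Bop \<Phi> \<xi> a (Bop \<Phi> \<xi> a f) u = 0"
  by (simp add: Bop_eval)

lemma Bop_add: "a \<in> \<Phi> \<Longrightarrow> Bop \<Phi> \<xi> a (\<lambda>u. f u + g u) u = Bop \<Phi> \<xi> a f u + Bop \<Phi> \<xi> a g u"
  by (simp add: Bop_eval)

lemma Bop_outside: "a \<in> \<Phi> \<Longrightarrow> u \<notin> weyl \<Phi> \<Longrightarrow> Bop \<Phi> \<xi> a f u = 0"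
  by (simp add: Bop_eval)

definition bruhat_step :: "'v \<Rightarrow> (('v \<Rightarrow> 'v) \<Rightarrow> ('v \<Rightarrow>\<^sub>0 int)) \<Rightarrow> (('v \<Rightarrow> 'v) \<Rightarrow> ('v \<Rightarrow>\<^sub>0 int))" where
  "bruhat_step a f = (\<lambda>u. f u + Bop \<Phi> \<xi> a f u)"

lemma bruhat_step_inverse:
  assumes "a \<in> \<Phi>"
  shows "bruhat_step (- a) (bruhat_step a f) = f"
  using assms by (simp add: bruhat_step_def Bop_minus Bop_add Bop_Bop)

lemma bruhat_step_outside: "a \<in> \<Phi> \<Longrightarrow> u \<notin> weyl \<Phi> \<Longrightarrow> bruhat_step a f u = f u"
  by (simp add: bruhat_step_def Bop_outside)

end

text \<open>The rank 2 system is laid out on a circle of \<open>2*m\<close> indices, opposite ones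
  carrying opposite roots, with reflections acting as reflections of the circle.
  \<open>seq_interval\<close> expresses convexity: a functional without zeros on the system is
  positive on a half circle.\<close>

locale dihedral_roots = root_system \<Phi> \<xi> for \<Phi> :: "'v::euclidean_space set" and \<xi> +
  fixes m :: int and \<gamma> :: "int \<Rightarrow> 'v"
  assumes m_pos: "m \<ge> 1"
    and seq_root: "\<gamma> i \<in> \<Phi>"
    and seq_anti: "\<gamma> (i + m) = - \<gamma> i"
    and seq_refl: "refl (\<gamma> i) (\<gamma> j) = - \<gamma> (2*i - j)"
    and seq_interval: "u \<in> weyl \<Phi> \<Longrightarrow> \<exists>p. \<forall>j. p < j \<and> j \<le> p + m \<longrightarrow> u (\<gamma> j) \<bullet> \<xi> > 0"
begin

lemma seq_period: "\<gamma> (i + 2*m*z) = \<gamma> i"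
proof -
  have 1: "\<gamma> (i + 2*m) = \<gamma> i" for i
    using seq_anti[of "i + m"] seq_anti[of i] by (simp add: algebra_simps)
  show ?thesis
  proof (induction z rule: int_induct[where k = 0])
    case (step1 z)
    then show ?case using 1[of "i + 2*m*z"] by (simp add: algebra_simps)
  next
    case (step2 z)
    then show ?case using 1[of "i + 2*m*(z - 1)"] by (simp add: algebra_simps)
  qed simp
qed

abbreviation s :: "int \<Rightarrow> 'v \<Rightarrow> 'v" where "s i \<equiv> refl (\<gamma> i)"

section \<open>The dihedral group and its cosets\<close>

lemma s_period: "s (i + m * z) = s i"
proof (induction z rule: int_induct[where k = 0])
  case (step1 z)
  then show ?case using seq_anti[of "i + m*z"] by (simp add: algebra_simps)
next
  case (step2 z)
  then show ?case using seq_anti[of "i + m*(z - 1)"] by (simp add: algebra_simps)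
qed simp

lemma s_weyl: "s i \<in> weyl \<Phi>"
  by (simp add: refl_weyl seq_root)

lemma s_conj: "s (2*i - j) v = s i (s j (s i v))"
proof -
  have "s (2*i - j) v = refl (s i (\<gamma> j)) (s i (s i v))" by (simp add: seq_refl)
  also have "\<dots> = s i (s j (s i v))" by (rule weyl_refl_conj[OF s_weyl])
  finally show ?thesis .
qed

lemma s_adjacent: "s (j+1) (s (j+2) v) = s j (s (j+1) v)"
  using s_conj[of "j+1" j v] by (simp add: algebra_simps)

text \<open>A product of two reflections is a rotation that depends only on the difference of the
  indices. Distant pairs are telescoped into adjacent ones, where \<open>s_conj\<close> gives the
  claim.\<close>

lemma s_shift1: "s (i+1) (s (j+1) v) = s i (s j v)"
proof (induction j arbitrary: v rule: int_induct[where k = i])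
  case (step1 j)
  have "s (i+1) (s (j+1+1) v) = s (i+1) (s (j+1) (s (j+1) (s (j+2) v)))" by (simp add: add.assoc)
  also have "\<dots> = s i (s j (s j (s (j+1) v)))" by (simp only: s_adjacent step1)
  finally show ?case by simp
next
  case (step2 j)
  have "s (i+1) (s j v) = s (i+1) (s (j+1) (s (j+1) (s j v)))" by simp
  also have "\<dots> = s i (s j (s (j+1) (s j v)))" by (rule step2)
  also have "s (j+1) (s j v) = s j (s (j-1) v)" using s_conj[of j "j-1" "s j v"] by simp
  finally show ?case by simp
qed simp

lemma s_shift: "s (i+n) (s (j+n) v) = s i (s j v)"
proof (induction n rule: int_induct[where k = 0])
  case (step1 n)
  then show ?case using s_shift1[of "i+n" "j+n" v] by (simp add: add.assoc)
next
  case (step2 n)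
  then show ?case using s_shift1[of "i+(n-1)" "j+(n-1)" v] by (simp add: algebra_simps)
qed simp

lemma s_comp: "s i (s j v) = s 0 (s (j - i) v)"
  using s_shift[of 0 i "j - i" v] by simp

text \<open>The elements of the coset of \<open>u\<close>, indexed so that \<open>\<gamma> (p+1), \<dots>, \<gamma> (p+m)\<close> are exactly the members
  of the rank 2 system that \<open>coset_elem u p0 p\<close> sends to positive roots, if this holds for \<open>u\<close> and \<open>p0\<close>.\<close>
definition coset_elem :: "('v \<Rightarrow> 'v) \<Rightarrow> int \<Rightarrow> int \<Rightarrow> 'v \<Rightarrow> 'v" where
  "coset_elem u p0 p = (if even (p + p0) then u \<circ> s 0 \<circ> s ((p - p0) div 2) else u \<circ> s ((p + p0 + 1) div 2))"

definition positive_from :: "('v \<Rightarrow> 'v) \<Rightarrow> int \<Rightarrow> bool" where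
  "positive_from u p \<longleftrightarrow> (\<forall>j. p < j \<and> j \<le> p + m \<longrightarrow> u (\<gamma> j) \<bullet> \<xi> > 0)"

lemma coset_elem_base: "coset_elem u p0 p0 = u"
  by (simp add: coset_elem_def)

lemma coset_elem_even: "coset_elem u p0 (p0 + 2*n) = u \<circ> s 0 \<circ> s n"
  by (simp add: coset_elem_def)

lemma coset_elem_odd: "coset_elem u p0 (2*i - 1 - p0) = u \<circ> s i"
  by (simp add: coset_elem_def)

lemma coset_elem_cases:
  obtains n where "p = p0 + 2*n" | i where "p = 2*i - 1 - (p0::int)"
proof (cases "even (p + p0)")
  case True
  then have "p = p0 + 2 * ((p - p0) div 2)" by auto
  then show ?thesis using that by blast
next
  case False
  then obtain k where "p + p0 = 2 * k + 1" by (rule oddE)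
  then have "p = 2 * (k + 1) - 1 - p0" by simp
  then show ?thesis using that by blast
qed

text \<open>The index \<open>p\<close> marks the gap between \<open>\<gamma> p\<close> and
  \<open>\<gamma> (p+1)\<close>, where the sign changes. Reflecting roots by
  \<open>j \<mapsto> 2*i - j\<close> therefore moves gaps by \<open>2*i - 1 - p\<close>.\<close>

lemma coset_elem_step: "coset_elem u p0 p \<circ> s i = coset_elem u p0 (2*i - 1 - p)"
proof (cases rule: coset_elem_cases[of p p0])
  case (1 n)
  then have "2*i - 1 - p = 2*(i-n) - 1 - p0" by simp
  then have "coset_elem u p0 (2*i - 1 - p) = u \<circ> s (i - n)" by (simp only: coset_elem_odd)
  moreover have "coset_elem u p0 p = u \<circ> s 0 \<circ> s n" by (simp only: 1 coset_elem_even)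
  ultimately show ?thesis by (simp add: fun_eq_iff s_comp[of n i])
next
  case (2 j)
  then have "2*i - 1 - p = p0 + 2*(i-j)" by simp
  then have "coset_elem u p0 (2*i - 1 - p) = u \<circ> s 0 \<circ> s (i - j)" by (simp only: coset_elem_even)
  moreover have "coset_elem u p0 p = u \<circ> s j" by (simp only: 2 coset_elem_odd)
  ultimately show ?thesis by (simp add: fun_eq_iff s_comp[of j i])
qed

lemma coset_elem_period: "coset_elem u p0 (p + 2*m) = coset_elem u p0 p"
proof (cases rule: coset_elem_cases[of p p0])
  case (1 n)
  then have "p + 2*m = p0 + 2*(n+m)" by simp
  then show ?thesis using s_period[of n 1] by (simp only: 1 coset_elem_even) simp
next
  case (2 j)
  then have "p + 2*m = 2*(j+m) - 1 - p0" by simp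
  then show ?thesis using s_period[of j 1] by (simp only: 2 coset_elem_odd) simp
qed

lemma coset_elem_weyl: "u \<in> weyl \<Phi> \<Longrightarrow> coset_elem u p0 p \<in> weyl \<Phi>"
  by (simp add: coset_elem_def seq_root)

lemma coset_elem_pos:
  assumes u: "u \<in> weyl \<Phi>" and p0: "positive_from u p0"
    and j: "p < j" "j \<le> p + m"
  shows "coset_elem u p0 p (\<gamma> j) \<bullet> \<xi> > 0"
proof (cases rule: coset_elem_cases[of p p0])
  case (1 n)
  have "coset_elem u p0 p (\<gamma> j) = u (\<gamma> (j - 2*n))"
    unfolding 1 coset_elem_even by (simp add: seq_refl linear_neg[OF linear_refl])
  then show ?thesis using p0 j 1 by (simp add: positive_from_def)
next
  case (2 i)
  have "coset_elem u p0 p (\<gamma> j) = u (\<gamma> (2*i - j + m))"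
    unfolding 2 coset_elem_odd by (simp add: seq_refl seq_anti)
  then show ?thesis using p0 j 2 by (simp add: positive_from_def)
qed

lemma coset_elem_neg:
  assumes u: "u \<in> weyl \<Phi>" and p0: "positive_from u p0"
    and j: "p - m < j" "j \<le> p"
  shows "coset_elem u p0 p (\<gamma> j) \<bullet> \<xi> < 0"
proof -
  have "coset_elem u p0 p (\<gamma> (j + m)) \<bullet> \<xi> > 0" by (rule coset_elem_pos[OF u p0]) (use j in auto)
  then show ?thesis
    by (simp add: seq_anti linear_neg[OF weyl_linear[OF coset_elem_weyl[OF u]]])
qed

text \<open>A shorter period would put a negative root inside the half circle of positive
  ones.\<close>

lemma no_smaller_period:
  assumes "\<And>j. \<gamma> (j + t) = \<gamma> j" "0 < t"
  shows "2*m \<le> t"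
proof (rule ccontr)
  assume t: "\<not> 2*m \<le> t"
  obtain p where p: "\<And>j. p < j \<Longrightarrow> j \<le> p + m \<Longrightarrow> \<gamma> j \<bullet> \<xi> > 0"
    using seq_interval[OF id_weyl] by auto
  show False
  proof (cases "t \<le> m")
    case True
    then show False using assms(1)[of p] p[of "p + t"] p[of "p + m"] seq_anti[of p] assms(2) by simp
  next
    case False
    then show False using assms(1)[of "p + 1"] p[of "p + 1"] p[of "p + 1 + t - m"] seq_anti[of "p + 1 + t - m"] t
      by simp
  qed
qed

lemma interval_range:
  assumes "u \<in> weyl \<Phi>"
  obtains p where "\<bar>p\<bar> \<le> m" "positive_from u p"
proof -
  obtain q where q: "\<And>j. q < j \<Longrightarrow> j \<le> q + m \<Longrightarrow> u (\<gamma> j) \<bullet> \<xi> > 0"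
    using seq_interval[OF assms] by blast
  define z where "z = (q + m) div (2*m)"
  define p where "p = (q + m) mod (2*m) - m"
  have eq: "q = p + 2*m*z" using div_mult_mod_eq[of "q + m" "2*m"] by (simp add: p_def z_def algebra_simps)
  have "0 \<le> (q + m) mod (2*m)" "(q + m) mod (2*m) < 2*m" using m_pos by auto
  then have "\<bar>p\<bar> \<le> m" by (simp add: p_def)
  moreover have "u (\<gamma> j) \<bullet> \<xi> > 0" if "p < j" "j \<le> p + m" for j
    using q[of "j + 2*m*z"] seq_period[of j z] that eq by simp
  ultimately show ?thesis using that by (simp add: positive_from_def)
qed

end

locale positive_dihedral_roots = dihedral_roots +
  assumes seq_pos: "1 \<le> j \<Longrightarrow> j \<le> m \<Longrightarrow> \<gamma> j \<in> pos_roots \<Phi> \<xi>"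
begin

lemma pos_range: "\<gamma> k \<in> pos_roots \<Phi> \<xi> \<Longrightarrow> \<gamma> k \<in> \<gamma> ` {1..m}"
proof -
  assume k: "\<gamma> k \<in> pos_roots \<Phi> \<xi>"
  define r where "r = k mod (2*m)"
  have eq: "\<gamma> k = \<gamma> r"
    using seq_period[of r "k div (2*m)"] by (simp add: r_def)
  have r: "0 \<le> r" "r < 2*m" using m_pos by (auto simp: r_def)
  have "1 \<le> r"
    using k eq seq_pos[of m] seq_anti[of 0] r m_pos by (cases "r = 0") (auto simp: pos_roots_def)
  moreover have "r \<le> m"
  proof (rule ccontr)
    assume "\<not> r \<le> m"
    then show False using k eq seq_pos[of "r - m"] seq_anti[of "r - m"] r by (auto simp: pos_roots_def)
  qed
  ultimately show ?thesis using eq by auto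
qed

text \<open>Equal roots have equal reflections, which would force the period \<open>2*(j-i)\<close>,
  less than \<open>2*m\<close>.\<close>

lemma inj_seq: "inj_on \<gamma> {1..m}"
proof -
  have False if ij: "1 \<le> i" "i < j" "j \<le> m" "\<gamma> i = \<gamma> j" for i j
  proof -
    have per: "\<gamma> (2*i - k) = \<gamma> (2*j - k)" for k
      using seq_refl[of i k] seq_refl[of j k] ij by simp
    have "\<gamma> (k + 2*(j-i)) = \<gamma> k" for k using per[of "2*i - k"] by (simp add: algebra_simps)
    then show False using no_smaller_period[of "2*(j-i)"] ij by simp
  qed
  then show ?thesis by (intro linorder_inj_onI) auto
qed

context
  fixes u p0
  assumes u: "u \<in> weyl \<Phi>" and p0: "positive_from u p0"
begin

abbreviation "v \<equiv> coset_elem u p0"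

lemmas v_pos = coset_elem_pos[OF u p0] and v_neg = coset_elem_neg[OF u p0]
  and v_weyl = coset_elem_weyl[OF u]

definition outer :: "int \<Rightarrow> nat" where
  "outer p = card {c \<in> pos_roots \<Phi> \<xi> - \<gamma> ` {1..m}. v p c \<bullet> \<xi> < 0}"

lemma card_plane_inversions:
  assumes "\<bar>p\<bar> \<le> m"
  shows "int (card {c \<in> \<gamma> ` {1..m}. v p c \<bullet> \<xi> < 0}) = \<bar>p\<bar>"
proof -
  \<comment> \<open>The negative window of \<open>p\<close> ends at \<open>p\<close>. For
    \<open>p < 0\<close> its translate by \<open>2*m\<close> is the one that meets
    \<open>{1..m}\<close>, in the last \<open>\<bar>p\<bar>\<close> indices.\<close>
  define J where "J = (if p \<ge> 0 then {1..p} else {m+p+1..m})"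
  have "v p (\<gamma> j) \<bullet> \<xi> < 0 \<longleftrightarrow> j \<in> J" if "j \<in> {1..m}" for j
  proof -
    have "j \<in> J \<Longrightarrow> p - m < j \<and> j \<le> p \<or> p + 2*m - m < j \<and> j \<le> p + 2*m"
      "j \<notin> J \<Longrightarrow> p < j \<and> j \<le> p + m"
      using that assms by (auto simp: J_def split: if_splits)
    then show ?thesis
      using v_pos[of p j] v_neg[of p j] v_neg[of "p + 2*m" j]
      by (cases "j \<in> J") (auto simp: coset_elem_period not_less)
  qed
  moreover have J: "J \<subseteq> {1..m}" using assms by (auto simp: J_def)
  ultimately have "{c \<in> \<gamma> ` {1..m}. v p c \<bullet> \<xi> < 0} = \<gamma> ` J" by auto
  moreover have "card (\<gamma> ` J) = card J" using inj_on_subset[OF inj_seq J] by (rule card_image)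
  ultimately show ?thesis using assms by (simp add: J_def)
qed

lemma wlen_v:
  assumes "\<bar>p\<bar> \<le> m"
  shows "int (wlen \<Phi> \<xi> (v p)) = \<bar>p\<bar> + int (outer p)"
proof -
  have sub: "\<gamma> ` {1..m} \<subseteq> pos_roots \<Phi> \<xi>" using seq_pos by auto
  have "inversions (v p) = {c \<in> \<gamma> ` {1..m}. v p c \<bullet> \<xi> < 0} \<union> {c \<in> pos_roots \<Phi> \<xi> - \<gamma> ` {1..m}. v p c \<bullet> \<xi> < 0}"
    using sub by auto
  then have "card (inversions (v p)) = card {c \<in> \<gamma> ` {1..m}. v p c \<bullet> \<xi> < 0} + outer p"
    unfolding outer_def by (simp only:) (rule card_Un_disjoint, use finite_pos_roots in auto)
  then show ?thesis using card_plane_inversions[OF assms] by (simp add: wlen_inversions[OF v_weyl])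
qed

text \<open>The elements at \<open>p\<close> and \<open>q\<close> differ by a reflection whose root
  is inverted at \<open>q\<close>, so \<open>card_inversions_refl_le\<close> applies to the positive
  roots outside the rank 2 system.\<close>

lemma outer_mono:
  assumes "\<bar>p\<bar> < \<bar>q\<bar>" "\<bar>q\<bar> \<le> m" "odd (p + q)"
  shows "outer p \<le> outer q"
proof -
  obtain i where i: "1 \<le> i" "i \<le> m" "v p = v q \<circ> s i" "v q (\<gamma> i) \<bullet> \<xi> < 0"
  proof (cases "q > 0")
    case True
    define i where "i = (p + q + 1) div 2"
    have "2*i - 1 - q = p" using assms(3) by (auto simp: i_def elim!: oddE)
    moreover from this have "1 \<le> i" "i \<le> q" using assms True by auto
    ultimately show ?thesis using that[of i] coset_elem_step[of u p0 q i] v_neg[of q i] assms True by simp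
  next
    case False
    \<comment> \<open>The solution of \<open>2*i - 1 - q = p\<close> is nonpositive here; adding
      \<open>m\<close> keeps the reflection and brings the label into \<open>{1..m}\<close>.\<close>
    define i where "i = (p + q + 1) div 2 + m"
    have i: "2*i - 1 - q = p + 2*m" using assms(3) by (auto simp: i_def elim!: oddE)
    then have r: "q + m + 1 \<le> i" "i \<le> m" using assms False by auto
    have "v (q + 2*m) (\<gamma> i) \<bullet> \<xi> < 0" by (rule v_neg) (use r assms in auto)
    then show ?thesis
      using that[of i] coset_elem_step[of u p0 q i] i r assms by (simp add: coset_elem_period)
  qed
  show ?thesis unfolding outer_def i(3)
  proof (rule card_inversions_refl_le[OF _ seq_pos[OF i(1,2)] _ v_weyl i(4)])
    fix c assume c: "c \<in> pos_roots \<Phi> \<xi> - \<gamma> ` {1..m}" "s i c \<in> pos_roots \<Phi> \<xi>"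
    have "s i c \<notin> \<gamma> ` {1..m}"
    proof
      assume "s i c \<in> \<gamma> ` {1..m}"
      then obtain j where "s i c = \<gamma> j" by auto
      then have "c = s i (\<gamma> j)" by (metis refl_refl)
      then have "c = \<gamma> (2*i - j + m)" by (simp add: seq_refl seq_anti)
      then show False using c pos_range by blast
    qed
    then show "s i c \<in> pos_roots \<Phi> \<xi> - \<gamma> ` {1..m}" using c by blast
  qed blast
qed

lemma heights: "dihedral_heights m (\<lambda>p. int (wlen \<Phi> \<xi> (v p)))"
proof
  show "int (wlen \<Phi> \<xi> (v q)) - int (wlen \<Phi> \<xi> (v p)) \<ge> \<bar>q\<bar> - \<bar>p\<bar>"
    if "\<bar>p\<bar> < \<bar>q\<bar>" "\<bar>q\<bar> \<le> m" "odd (p + q)" for p q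
    using wlen_v[of p] wlen_v[of q] outer_mono[OF that] that by simp
qed (simp_all add: m_pos coset_elem_period)

lemma foldr_bruhat_step_v:
  assumes "set js \<subseteq> {1..m}"
  shows "foldr (\<lambda>i. bruhat_step (\<gamma> i)) js f (v p)
    = foldr (yb_step (\<lambda>p. int (wlen \<Phi> \<xi> (v p)))) js (\<lambda>p. f (v p)) p"
  using assms
proof (induction js arbitrary: p)
  case (Cons i js)
  then have "\<gamma> i \<in> pos_roots \<Phi> \<xi>" using seq_pos by simp
  moreover define g h where "g = foldr (\<lambda>i. bruhat_step (\<gamma> i)) js f"
    and "h = foldr (yb_step (\<lambda>p. int (wlen \<Phi> \<xi> (v p)))) js (\<lambda>p. f (v p))"
  moreover have "g (v p) = h p" for p using Cons by (simp add: g_def h_def)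
  ultimately have "bruhat_step (\<gamma> i) g (v p) = yb_step (\<lambda>p. int (wlen \<Phi> \<xi> (v p))) i h p"
    by (simp add: bruhat_step_def Bop_eval seq_root yb_step_def coset_elem_step v_weyl)
  then show ?case by (simp add: g_def h_def)
qed simp

end

lemma bruhat_yang_baxter_pos:
  "foldr (\<lambda>i. bruhat_step (\<gamma> i)) [1..m] f = foldr (\<lambda>i. bruhat_step (\<gamma> i)) (rev [1..m]) f"
proof
  fix u
  show "foldr (\<lambda>i. bruhat_step (\<gamma> i)) [1..m] f u = foldr (\<lambda>i. bruhat_step (\<gamma> i)) (rev [1..m]) f u"
  proof (cases "u \<in> weyl \<Phi>")
    case False
    have "foldr (\<lambda>i. bruhat_step (\<gamma> i)) is f u = f u" for "is"
      by (induction "is") (auto simp: bruhat_step_outside seq_root False)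
    then show ?thesis by simp
  next
    case u: True
    then obtain p where p: "\<bar>p\<bar> \<le> m" and p0: "positive_from u p"
      using interval_range by blast
    interpret dihedral_heights m "\<lambda>q. int (wlen \<Phi> \<xi> (coset_elem u p q))"
      by (rule heights[OF u p0])
    have "periodic (\<lambda>q. f (coset_elem u p q))"
      by (simp add: periodic_def coset_elem_period)
    note yang_baxter_heights[OF this p]
    then show ?thesis
      using foldr_bruhat_step_v[OF u p0, where js = "[1..m]" and p = p and f = f] foldr_bruhat_step_v[OF u p0, where js = "rev [1..m]" and p = p and f = f]
      by (simp add: coset_elem_base)
  qed
qed

end

context dihedral_roots
begin

abbreviation bstep where "bstep i \<equiv> bruhat_step (\<gamma> i)"

lemma bstep_inverse: "bstep (i + m) (bstep i f) = f" "bstep i (bstep (i + m) f) = f"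
  using bruhat_step_inverse[OF seq_root, of i f] bruhat_step_inverse[OF seq_root, of "i + m" f]
  by (simp_all add: seq_anti)

text \<open>Multiply by the inverse of the outer factor, which is the factor of the opposite root, on both sides.\<close>
lemma bruhat_yang_baxter_rotate:
  assumes "\<And>f. foldr bstep [q+1..q+m] f = foldr bstep (rev [q+1..q+m]) f"
  shows "foldr bstep [q+1+1..q+1+m] f = foldr bstep (rev [q+1+1..q+1+m]) f"
proof -
  define M where "M = foldr bstep [q+1+1..q+m]"
  define M' where "M' = foldr bstep (rev [q+1+1..q+m])"
  have fwd: "[q+1..q+m] = (q+1) # [q+1+1..q+m]" using m_pos by (simp add: upto_rec1)
  have bwd: "[q+1+1..q+1+m] = [q+1+1..q+m] @ [q+1+m]"
    using m_pos upto_rec2[of "q+1+1" "q+1+m"] by simp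
  have eq: "bstep (q+1) (M f) = M' (bstep (q+1) f)" for f
    using assms[of f] unfolding fwd by (simp add: M_def M'_def)
  have "M (bstep (q+1+m) f) = bstep (q+1+m) (bstep (q+1) (M (bstep (q+1+m) f)))"
    by (simp add: bstep_inverse)
  also have "\<dots> = bstep (q+1+m) (M' f)" by (simp only: eq bstep_inverse)
  finally show ?thesis unfolding bwd by (simp add: M_def M'_def)
qed

lemma foldr_bstep_shift:
  "foldr (\<lambda>i. bstep (i + p)) is f = foldr bstep (map (\<lambda>i. i + p) is) f"
  by (simp add: foldr_map comp_def)

lemma map_add_upto: "map (\<lambda>i. i + p) [1..m] = [p+1..p+m]"
  by (rule nth_equalityI) (auto simp: nth_upto)

text \<open>Some window of \<open>m\<close> consecutive roots is positive. The identity holds there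
  and is rotated one index at a time to the window \<open>1..m\<close>.\<close>

lemma bruhat_yang_baxter: "foldr bstep [1..m] f = foldr bstep (rev [1..m]) f"
proof -
  obtain p where p: "\<And>j. p < j \<Longrightarrow> j \<le> p + m \<Longrightarrow> \<gamma> j \<bullet> \<xi> > 0"
    using seq_interval[OF id_weyl] by auto
  \<comment> \<open>Rotation only raises the index, so the positive window is translated by whole
    periods to start at or below 1.\<close>
  define q where "q = p - 2*m*\<bar>p\<bar>"
  have "1 * \<bar>p\<bar> \<le> 2 * m * \<bar>p\<bar>" using m_pos by (intro mult_right_mono) auto
  then have q: "q \<le> 0" by (simp add: q_def)
  have qpos: "\<gamma> j \<bullet> \<xi> > 0" if "q < j" "j \<le> q + m" for j
    using p[of "j + 2*m*\<bar>p\<bar>"] seq_period[of j "\<bar>p\<bar>"] that by (simp add: q_def)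
  interpret sh: positive_dihedral_roots \<Phi> \<xi> m "\<lambda>i. \<gamma> (i + q)"
  proof
    show "\<gamma> (i + q) \<in> \<Phi>" for i by (rule seq_root)
    show "\<gamma> (i + m + q) = - \<gamma> (i + q)" for i using seq_anti[of "i + q"] by (simp add: algebra_simps)
    show "refl (\<gamma> (i + q)) (\<gamma> (j + q)) = - \<gamma> (2*i - j + q)" for i j
      using seq_refl[of "i + q" "j + q"] by (simp add: algebra_simps)
    show "\<exists>p. \<forall>j. p < j \<and> j \<le> p + m \<longrightarrow> u (\<gamma> (j + q)) \<bullet> \<xi> > 0" if u: "u \<in> weyl \<Phi>" for u
    proof -
      obtain p where "\<forall>j. p < j \<and> j \<le> p + m \<longrightarrow> u (\<gamma> j) \<bullet> \<xi> > 0" using seq_interval[OF u] by blast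
      then show ?thesis by (intro exI[of _ "p - q"]) auto
    qed
    show "\<gamma> (j + q) \<in> pos_roots \<Phi> \<xi>" if "1 \<le> j" "j \<le> m" for j
      using qpos[of "j + q"] that by (simp add: pos_roots_def seq_root)
  qed (rule m_pos)
  have "foldr bstep [q+1..q+m] f = foldr bstep (rev [q+1..q+m]) f" for f
    using sh.bruhat_yang_baxter_pos[of f]
    by (simp only: foldr_bstep_shift rev_map[symmetric] map_add_upto)
  moreover have "foldr bstep [q+int n+1..q+int n+m] f = foldr bstep (rev [q+int n+1..q+int n+m]) f"
    if "\<And>f. foldr bstep [q+1..q+m] f = foldr bstep (rev [q+1..q+m]) f" for n f
  proof (induction n arbitrary: f)
    case (Suc n)
    show ?case using bruhat_yang_baxter_rotate[OF Suc] by (simp add: algebra_simps)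
  qed (simp add: that)
  ultimately have "foldr bstep [q+int n+1..q+int n+m] f = foldr bstep (rev [q+int n+1..q+int n+m]) f" for n
    by blast
  from this[of "nat (- q)"] show ?thesis using q by simp
qed

end

section \<open>Reduction of the \<open>R\<close>-matrix to the Bruhat operators\<close>

lemma xmon_mult: "xmon a * xmon b = xmon (a + b)"
  by (simp add: xmon_def mult_single)

lemma xmon_0 [simp]: "xmon 0 = 1"
  by (simp add: xmon_def)

lemma op_prod_foldr: "op_prod R gs x = foldr R gs x"
  unfolding op_prod_def by (induction gs) auto

context root_system
begin

text \<open>Unlike \<open>Kmod\<close>, this class is stable under \<open>Xop\<close> for arbitrary
  vectors, such as multiples of half sums of roots. Vanishing outside W matters because
  \<open>Xop\<close> is additive in its exponent only where \<open>u\<close> is linear.\<close>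

definition supported :: "(('v \<Rightarrow> 'v) \<Rightarrow> ('v \<Rightarrow>\<^sub>0 int)) \<Rightarrow> bool" where
  "supported f \<longleftrightarrow> (\<forall>u. u \<notin> weyl \<Phi> \<longrightarrow> f u = 0)"

lemma supported_Xop: "supported f \<Longrightarrow> supported (Xop \<Phi> \<xi> x f)"
  by (simp add: supported_def Xop_def)

lemma supported_bruhat_step: "a \<in> \<Phi> \<Longrightarrow> supported f \<Longrightarrow> supported (bruhat_step a f)"
  by (simp add: supported_def bruhat_step_outside)

lemma supported_Rop: "a \<in> \<Phi> \<Longrightarrow> supported f \<Longrightarrow> supported (Rop \<Phi> \<xi> l k a f)"
  by (simp add: supported_def Rop_def Xop_def Bop_outside)

lemma supported_Kmod: "f \<in> Kmod \<Phi> \<xi> \<Longrightarrow> supported f"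
  by (simp add: supported_def Kmod_def)

lemma Xop_Xop:
  assumes "u \<in> weyl \<Phi>"
  shows "Xop \<Phi> \<xi> x (Xop \<Phi> \<xi> y f) u = Xop \<Phi> \<xi> (x + y) f u"
  by (simp add: Xop_def mult.assoc[symmetric] xmon_mult scaleR_add_right
      linear_add[OF weyl_linear[OF assms]])

lemma Xop_zero: "u \<in> weyl \<Phi> \<Longrightarrow> Xop \<Phi> \<xi> 0 f u = f u"
  by (simp add: Xop_def linear_0[OF weyl_linear])

lemma Xop_inverse:
  assumes "supported f"
  shows "Xop \<Phi> \<xi> x (Xop \<Phi> \<xi> (- x) f) = f"
proof
  fix u show "Xop \<Phi> \<xi> x (Xop \<Phi> \<xi> (- x) f) u = f u"
  proof (cases "u \<in> weyl \<Phi>")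
    case True
    then show ?thesis by (simp add: Xop_Xop Xop_zero)
  next
    case False
    then show ?thesis using assms by (simp add: supported_def Xop_def)
  qed
qed

lemma Xop_cong: "f u = g u \<Longrightarrow> Xop \<Phi> \<xi> x f u = Xop \<Phi> \<xi> x g u"
  by (simp add: Xop_def)

lemma Bop_Xop:
  assumes "a \<in> \<Phi>" "u \<in> weyl \<Phi>"
  shows "Bop \<Phi> \<xi> a (Xop \<Phi> \<xi> y f) u = Xop \<Phi> \<xi> (refl a y) (Bop \<Phi> \<xi> a f) u"
  using assms by (simp add: Bop_eval Xop_def)

lemma Xop_add: "Xop \<Phi> \<xi> x (\<lambda>u. f u + g u) u = Xop \<Phi> \<xi> x f u + Xop \<Phi> \<xi> x g u"
  by (simp add: Xop_def distrib_left)

text \<open>Each summand of \<open>Rop\<close> imposes one condition on \<open>x\<close>: the first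
  shifts \<open>y\<close> by \<open>k a\<close>, the second reflects it by \<open>Bop_Xop\<close>.
  They agree when \<open>y - l\<close> pairs to \<open>-k\<close> with
  \<open>coroot a\<close>.\<close>

lemma Rop_Xop:
  assumes a: "a \<in> \<Phi>" and f: "supported f"
    and x: "x = of_int k *\<^sub>R a + y" "x = (l \<bullet> coroot a) *\<^sub>R a + refl a y"
  shows "Rop \<Phi> \<xi> l k a (Xop \<Phi> \<xi> y f) = Xop \<Phi> \<xi> x (bruhat_step a f)"
proof
  fix u
  show "Rop \<Phi> \<xi> l k a (Xop \<Phi> \<xi> y f) u = Xop \<Phi> \<xi> x (bruhat_step a f) u"
  proof (cases "u \<in> weyl \<Phi>")
    case True
    have "Xop \<Phi> \<xi> ((l \<bullet> coroot a) *\<^sub>R a) (Bop \<Phi> \<xi> a (Xop \<Phi> \<xi> y f)) u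
        = Xop \<Phi> \<xi> ((l \<bullet> coroot a) *\<^sub>R a) (Xop \<Phi> \<xi> (refl a y) (Bop \<Phi> \<xi> a f)) u"
      by (rule Xop_cong) (rule Bop_Xop[OF a True])
    then show ?thesis
      by (simp add: Rop_def bruhat_step_def Xop_add Xop_Xop True flip: x)
  next
    case False
    then show ?thesis
      using supported_Rop[OF a supported_Xop[OF f]] supported_Xop[OF supported_bruhat_step[OF a f]]
      by (simp add: supported_def)
  qed
qed

lemma Rop_conj:
  assumes a: "a \<in> \<Phi>" and f: "supported f"
  shows "Rop \<Phi> \<xi> l k a f = Xop \<Phi> \<xi> l (\<lambda>u. Xop \<Phi> \<xi> (of_int k *\<^sub>R a) (Xop \<Phi> \<xi> (- l) f) u
    + Bop \<Phi> \<xi> a (Xop \<Phi> \<xi> (- l) f) u)"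
proof
  fix u
  show "Rop \<Phi> \<xi> l k a f u = Xop \<Phi> \<xi> l (\<lambda>u. Xop \<Phi> \<xi> (of_int k *\<^sub>R a) (Xop \<Phi> \<xi> (- l) f) u
    + Bop \<Phi> \<xi> a (Xop \<Phi> \<xi> (- l) f) u) u"
  proof (cases "u \<in> weyl \<Phi>")
    case True
    have *: "Xop \<Phi> \<xi> l (Bop \<Phi> \<xi> a (Xop \<Phi> \<xi> (- l) f)) u = Xop \<Phi> \<xi> l (Xop \<Phi> \<xi> (refl a (- l)) (Bop \<Phi> \<xi> a f)) u"
      by (rule Xop_cong) (rule Bop_Xop[OF a True])
    have "l + refl a (- l) = (l \<bullet> coroot a) *\<^sub>R a" by (simp add: refl_def)
    moreover have "Xop \<Phi> \<xi> l (Xop \<Phi> \<xi> (of_int k *\<^sub>R a) (Xop \<Phi> \<xi> (- l) f)) u = Xop \<Phi> \<xi> (of_int k *\<^sub>R a) f u"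
      using Xop_Xop[OF True, of l "of_int k *\<^sub>R a" "Xop \<Phi> \<xi> (- l) f"] by (simp add: Xop_Xop True)
    ultimately show ?thesis by (simp add: Rop_def Xop_add * Xop_Xop True)
  next
    case False
    then show ?thesis using supported_Rop[OF a f] f a
      by (simp add: supported_def Xop_def Bop_outside)
  qed
qed

text \<open>The exponent \<open>(l \<bullet> coroot a) a\<close> is even in \<open>a\<close> while
  \<open>Bop\<close> is odd, so the mixed terms cancel; the term with two Bruhat operators vanishes
  by \<open>Bop_Bop\<close>.\<close>

lemma Rop_inverse:
  assumes a: "a \<in> \<Phi>" and f: "supported f"
  shows "Rop \<Phi> \<xi> l k (- a) (Rop \<Phi> \<xi> l k a f) = f"
proof
  fix u
  show "Rop \<Phi> \<xi> l k (- a) (Rop \<Phi> \<xi> l k a f) u = f u"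
  proof (cases "u \<in> weyl \<Phi>")
    case False
    then show ?thesis
      using f supported_Rop[OF _ supported_Rop[OF a f], of "- a"] a by (simp add: supported_def)
  next
    case u: True
    let ?n = "l \<bullet> coroot a"
    let ?B = "Bop \<Phi> \<xi> a"
    let ?g = "\<lambda>u. Xop \<Phi> \<xi> (of_int k *\<^sub>R a) f u + Xop \<Phi> \<xi> (?n *\<^sub>R a) (?B f) u"
    have R: "Rop \<Phi> \<xi> l k a f = ?g" by (simp add: Rop_def)
    have "?B (Xop \<Phi> \<xi> (?n *\<^sub>R a) (?B f)) u = 0"
      unfolding Bop_Xop[OF a u] by (simp add: Xop_def Bop_Bop[OF a])
    then have Bg: "?B ?g u = Xop \<Phi> \<xi> (- (of_int k *\<^sub>R a)) (?B f) u"
      using a u by (simp add: Bop_add Bop_Xop linear_scale[OF linear_refl])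
    have "Rop \<Phi> \<xi> l k (- a) ?g u = Xop \<Phi> \<xi> (- (of_int k *\<^sub>R a)) ?g u - Xop \<Phi> \<xi> (?n *\<^sub>R a) (?B ?g) u"
      using a by (simp add: Rop_def Bop_minus Xop_def)
    also have "Xop \<Phi> \<xi> (?n *\<^sub>R a) (?B ?g) u = Xop \<Phi> \<xi> (?n *\<^sub>R a) (Xop \<Phi> \<xi> (- (of_int k *\<^sub>R a)) (?B f)) u"
      by (rule Xop_cong) (rule Bg)
    finally show ?thesis using u by (simp add: R Xop_add Xop_Xop Xop_zero)
  qed
qed

section \<open>Stability of the weight lattice and of \<open>Kmod\<close>\<close>

lemma weight_lattice_add: "x \<in> weight_lattice \<Phi> \<Longrightarrow> y \<in> weight_lattice \<Phi> \<Longrightarrow> x + y \<in> weight_lattice \<Phi>"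
  by (simp add: weight_lattice_def inner_add_left)

lemma weight_lattice_scale: "c \<in> \<int> \<Longrightarrow> x \<in> weight_lattice \<Phi> \<Longrightarrow> c *\<^sub>R x \<in> weight_lattice \<Phi>"
  by (simp add: weight_lattice_def)

lemma weight_lattice_root: "a \<in> \<Phi> \<Longrightarrow> a \<in> weight_lattice \<Phi>"
  by (simp add: weight_lattice_def integral)

lemma weight_lattice_weyl:
  assumes "u \<in> weyl \<Phi>" "x \<in> weight_lattice \<Phi>"
  shows "u x \<in> weight_lattice \<Phi>"
proof -
  have "set ls \<subseteq> \<Phi> \<Longrightarrow> prod_refl ls x \<in> weight_lattice \<Phi>" for ls
  proof (induction ls)
    case (Cons a ls)
    let ?y = "prod_refl ls x"
    have y: "?y \<in> weight_lattice \<Phi>" "a \<in> \<Phi>" using Cons by auto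
    then have "- (?y \<bullet> coroot a) \<in> \<int>" by (simp add: weight_lattice_def)
    from weight_lattice_add[OF y(1) weight_lattice_scale[OF this weight_lattice_root[OF y(2)]]]
    show ?case by (simp add: refl_def)
  qed (simp add: assms)
  then show ?thesis using assms(1) by (auto simp: weyl_def)
qed

lemma Ztilde_zero: "0 \<in> Ztilde \<Phi> \<xi>"
  by (simp add: Ztilde_def)

lemma Ztilde_uminus: "p \<in> Ztilde \<Phi> \<xi> \<Longrightarrow> - p \<in> Ztilde \<Phi> \<xi>"
  by (auto simp: Ztilde_def in_keys_iff subset_iff)

lemma Ztilde_add: "p \<in> Ztilde \<Phi> \<xi> \<Longrightarrow> q \<in> Ztilde \<Phi> \<xi> \<Longrightarrow> p + q \<in> Ztilde \<Phi> \<xi>"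
  using Poly_Mapping.keys_add[of p q] unfolding Ztilde_def by blast

lemma Ztilde_xmon_mult:
  assumes x: "x \<in> weight_lattice \<Phi>" and p: "p \<in> Ztilde \<Phi> \<xi>"
  shows "xmon ((1 / coxeter_number \<Phi> \<xi>) *\<^sub>R x) * p \<in> Ztilde \<Phi> \<xi>"
proof -
  let ?c = "1 / coxeter_number \<Phi> \<xi>"
  have "Poly_Mapping.keys (xmon (?c *\<^sub>R x) * p) \<subseteq> {?c *\<^sub>R x + b | b. b \<in> Poly_Mapping.keys p}"
    using keys_mult[of "xmon (?c *\<^sub>R x)" p] by (auto simp: xmon_def split: if_splits)
  also have "\<dots> \<subseteq> {?c *\<^sub>R l | l. l \<in> weight_lattice \<Phi>}"
  proof
    fix z assume "z \<in> {?c *\<^sub>R x + b | b. b \<in> Poly_Mapping.keys p}"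
    then obtain y where "y \<in> weight_lattice \<Phi>" "z = ?c *\<^sub>R x + ?c *\<^sub>R y"
      using p unfolding Ztilde_def by blast
    then show "z \<in> {?c *\<^sub>R l | l. l \<in> weight_lattice \<Phi>}"
      using weight_lattice_add[OF x] by (auto simp flip: scaleR_add_right)
  qed
  finally show ?thesis by (simp add: Ztilde_def)
qed

lemma Xop_Kmod:
  assumes "x \<in> weight_lattice \<Phi>" "f \<in> Kmod \<Phi> \<xi>"
  shows "Xop \<Phi> \<xi> x f \<in> Kmod \<Phi> \<xi>"
proof -
  have "Xop \<Phi> \<xi> x f u \<in> Ztilde \<Phi> \<xi>" for u
    using assms Ztilde_xmon_mult[OF weight_lattice_weyl[OF _ assms(1)], of u "f u"] Ztilde_zero
    by (cases "u \<in> weyl \<Phi>") (auto simp: Xop_def Kmod_def)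
  then show ?thesis using assms by (simp add: Kmod_def Xop_def)
qed

lemma Bop_Kmod: "a \<in> \<Phi> \<Longrightarrow> f \<in> Kmod \<Phi> \<xi> \<Longrightarrow> Bop \<Phi> \<xi> a f \<in> Kmod \<Phi> \<xi>"
  by (auto simp: Kmod_def Bop_eval Ztilde_zero Ztilde_uminus)

lemma Rop_Kmod:
  assumes "a \<in> \<Phi>" "l \<in> weight_lattice \<Phi>" "f \<in> Kmod \<Phi> \<xi>"
  shows "Rop \<Phi> \<xi> l k a f \<in> Kmod \<Phi> \<xi>"
proof -
  have "l \<bullet> coroot a \<in> \<int>" using assms by (simp add: weight_lattice_def)
  then have "Xop \<Phi> \<xi> ((l \<bullet> coroot a) *\<^sub>R a) (Bop \<Phi> \<xi> a f) \<in> Kmod \<Phi> \<xi>"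
    using assms by (intro Xop_Kmod weight_lattice_scale weight_lattice_root Bop_Kmod)
  moreover have "Xop \<Phi> \<xi> (of_int k *\<^sub>R a) f \<in> Kmod \<Phi> \<xi>"
    using assms by (intro Xop_Kmod weight_lattice_scale weight_lattice_root) auto
  ultimately show ?thesis by (simp add: Kmod_def Rop_def Ztilde_add)
qed

end

context dihedral_roots
begin

text \<open>The half sums of \<open>m\<close> consecutive \<open>\<gamma>\<close> interpolate between \<open>\<rho>\<close> and \<open>-\<rho>\<close> of the rank 2 system;
  conjugating the \<open>j\<close>-th factor by the \<open>j\<close>-th one turns the \<open>R\<close>-matrix into the case \<open>k = 0\<close>.\<close>
definition half_sum :: "int \<Rightarrow> 'v" where
  "half_sum j = (1/2) *\<^sub>R (\<Sum>i\<in>{j..j+m-1}. \<gamma> i)"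

text \<open>Moving the window by one replaces \<open>\<gamma> j\<close> by
  \<open>\<gamma> (j+m) = - \<gamma> j\<close>.\<close>

lemma half_sum_Suc: "half_sum j = \<gamma> j + half_sum (j + 1)"
proof -
  have "{j..j+m-1} = insert j {j+1..j+m-1}" "{j+1..j+m} = insert (j+m) {j+1..j+m-1}"
    using m_pos by auto
  then show ?thesis
    by (simp add: half_sum_def seq_anti scaleR_add_right flip: scaleR_left.add) (simp add: algebra_simps flip: scaleR_left.add)
qed

text \<open>\<open>s j\<close> sends \<open>\<gamma> i\<close> to
  \<open>\<gamma> (2*j + m - i)\<close> and thereby reverses one window onto the other.\<close>

lemma refl_half_sum: "s j (half_sum (j + 1)) = half_sum j"
proof -
  have "(\<Sum>i\<in>{j+1..j+m}. s j (\<gamma> i)) = (\<Sum>i\<in>{j..j+m-1}. \<gamma> i)"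
    by (rule sum.reindex_bij_witness[of _ "\<lambda>i. 2*j + m - i" "\<lambda>i. 2*j + m - i"])
      (auto simp: seq_refl seq_anti[of "2*j - i" for i, simplified] algebra_simps simp flip: seq_anti)
  then show ?thesis
    by (simp add: half_sum_def linear_scale[OF linear_refl] linear_sum[OF linear_refl])
qed

lemma refl_half_sum': "s j (half_sum j) = half_sum (j + 1)"
  using refl_half_sum by (metis refl_refl)

lemma half_sum_anti: "half_sum (1 + m) = - half_sum 1"
proof -
  have "(\<Sum>i\<in>{1+m..1+m+m-1}. \<gamma> i) = (\<Sum>i\<in>{1..m}. - \<gamma> i)"
    by (rule sum.reindex_bij_witness[of _ "\<lambda>i. i + m" "\<lambda>i. i - m"]) (auto simp flip: seq_anti)
  then show ?thesis by (simp add: half_sum_def sum_negf)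
qed

context
  fixes l :: 'v and k :: int and f
  assumes f: "supported f"
begin

lemma supported_foldr: "supported (foldr bstep js f)"
  by (induction js) (simp_all add: f supported_bruhat_step seq_root)

lemma foldr_Rop_fwd:
  assumes "j \<le> m + 1"
  shows "foldr (\<lambda>i. Rop \<Phi> \<xi> l k (\<gamma> i)) [j..m] (Xop \<Phi> \<xi> (l + of_int k *\<^sub>R half_sum (1 + m)) f)
    = Xop \<Phi> \<xi> (l + of_int k *\<^sub>R half_sum j) (foldr bstep [j..m] f)"
  using assms
proof (induction j rule: int_le_induct)
  case base
  then show ?case by (simp add: add.commute)
next
  case (step j)
  have "Rop \<Phi> \<xi> l k (\<gamma> (j-1)) (Xop \<Phi> \<xi> (l + of_int k *\<^sub>R half_sum j) (foldr bstep [j..m] f))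
    = Xop \<Phi> \<xi> (l + of_int k *\<^sub>R half_sum (j-1)) (bstep (j-1) (foldr bstep [j..m] f))"
  proof (rule Rop_Xop[OF seq_root supported_foldr])
    show "l + of_int k *\<^sub>R half_sum (j-1) = of_int k *\<^sub>R \<gamma> (j-1) + (l + of_int k *\<^sub>R half_sum j)"
      using half_sum_Suc[of "j-1"] by (simp add: algebra_simps)
    show "l + of_int k *\<^sub>R half_sum (j-1) =
        (l \<bullet> coroot (\<gamma> (j-1))) *\<^sub>R \<gamma> (j-1) + s (j-1) (l + of_int k *\<^sub>R half_sum j)"
      using refl_half_sum[of "j-1"]
      by (simp add: linear_add[OF linear_refl] linear_scale[OF linear_refl]) (simp add: refl_def)
  qed
  then show ?case using step by (simp add: upto_rec1[of "j-1"])
qed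

lemma foldr_Rop_bwd:
  assumes "0 \<le> j"
  shows "foldr (\<lambda>i. Rop \<Phi> \<xi> l k (\<gamma> i)) (rev [1..j]) (Xop \<Phi> \<xi> (l - of_int k *\<^sub>R half_sum 1) f)
    = Xop \<Phi> \<xi> (l - of_int k *\<^sub>R half_sum (1 + j)) (foldr bstep (rev [1..j]) f)"
  using assms
proof (induction j rule: int_ge_induct)
  case base
  then show ?case by simp
next
  case (step j)
  have "Rop \<Phi> \<xi> l k (\<gamma> (j+1)) (Xop \<Phi> \<xi> (l - of_int k *\<^sub>R half_sum (j+1)) (foldr bstep (rev [1..j]) f))
    = Xop \<Phi> \<xi> (l - of_int k *\<^sub>R half_sum (j+1+1)) (bstep (j+1) (foldr bstep (rev [1..j]) f))"
  proof (rule Rop_Xop[OF seq_root supported_foldr])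
    show "l - of_int k *\<^sub>R half_sum (j+1+1) = of_int k *\<^sub>R \<gamma> (j+1) + (l - of_int k *\<^sub>R half_sum (j+1))"
      using half_sum_Suc[of "j+1"] by (simp add: algebra_simps)
    show "l - of_int k *\<^sub>R half_sum (j+1+1) =
        (l \<bullet> coroot (\<gamma> (j+1))) *\<^sub>R \<gamma> (j+1) + s (j+1) (l - of_int k *\<^sub>R half_sum (j+1))"
      using refl_half_sum'[of "j+1"]
      by (simp add: linear_diff[OF linear_refl] linear_scale[OF linear_refl]) (simp add: refl_def)
  qed
  moreover have "rev [1..j+1] = (j+1) # rev [1..j]" using step by (simp add: upto_rec2)
  ultimately show ?case using step by (simp add: add.commute[of 1])
qed

text \<open>Since \<open>half_sum (1 + m) = - half_sum 1\<close>, both products start with exponent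
  \<open>l - k half_sum 1\<close> and end with \<open>l + k half_sum 1\<close>.\<close>

lemma Rop_yang_baxter:
  "foldr (\<lambda>i. Rop \<Phi> \<xi> l k (\<gamma> i)) [1..m] (Xop \<Phi> \<xi> (l - of_int k *\<^sub>R half_sum 1) f)
    = foldr (\<lambda>i. Rop \<Phi> \<xi> l k (\<gamma> i)) (rev [1..m]) (Xop \<Phi> \<xi> (l - of_int k *\<^sub>R half_sum 1) f)"
  using foldr_Rop_fwd[of 1] foldr_Rop_bwd[of m] m_pos bruhat_yang_baxter[of f]
  by (simp add: half_sum_anti)

end

lemma op_prod_yang_baxter:
  assumes "supported f"
  shows "op_prod (Rop \<Phi> \<xi> l k) (map \<gamma> [1..m]) f = op_prod (Rop \<Phi> \<xi> l k) (rev (map \<gamma> [1..m])) f"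
proof -
  define g where "g = Xop \<Phi> \<xi> (- (l - of_int k *\<^sub>R half_sum 1)) f"
  have "supported g" using assms supported_Xop by (simp add: g_def)
  moreover have "f = Xop \<Phi> \<xi> (l - of_int k *\<^sub>R half_sum 1) g"
    unfolding g_def by (rule Xop_inverse[OF assms, symmetric])
  ultimately show ?thesis
    using Rop_yang_baxter[of g l k] by (simp add: op_prod_foldr foldr_map rev_map comp_def)
qed

section \<open>Identification with \<open>rank2_seq\<close>\<close>

lemma rotation: "s 1 (s 0 (\<gamma> j)) = \<gamma> (j + 2)"
  by (simp add: seq_refl linear_neg[OF linear_refl] add.commute)

lemma rotation_funpow: "((s 1 \<circ> s 0) ^^ n) (\<gamma> j) = \<gamma> (j + 2 * int n)"
  by (induction n) (simp_all add: rotation algebra_simps)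

lemma rotation_funpow_refl: "((s 1 \<circ> s 0) ^^ n) v = s (int n) (s 0 v)"
proof (induction n)
  case (Suc n)
  have "s 1 (s 0 x) = s (int n + 1) (s (int n) x)" for x
    using s_shift[of 1 "int n" 0 x] by (simp add: add.commute)
  then show ?case using Suc by (simp add: add.commute)
qed simp

lemma rotation_order: "(LEAST n. n > 0 \<and> (s 1 \<circ> s 0) ^^ n = id) = nat m"
proof (rule Least_equality)
  have "(s 1 \<circ> s 0) ^^ nat m = id"
    using m_pos s_period[of 0 1] by (simp add: fun_eq_iff rotation_funpow_refl)
  then show "0 < nat m \<and> (s 1 \<circ> s 0) ^^ nat m = id" using m_pos by simp
  fix n assume n: "0 < n \<and> (s 1 \<circ> s 0) ^^ n = id"
  then have "\<gamma> (j + 2 * int n) = \<gamma> j" for j using rotation_funpow[of n j] by simp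
  then show "nat m \<le> n" using no_smaller_period[of "2 * int n"] n by simp
qed

text \<open>With \<open>\<alpha> = \<gamma> 1\<close> and
  \<open>\<beta> = - \<gamma> 0 = \<gamma> m\<close> the rotation raises indices by two, so the
  orbits of \<open>\<alpha>\<close> and of \<open>s_\<alpha>(\<beta>) = \<gamma> 2\<close>
  interleave.\<close>

lemma rank2_seq_eq: "rank2_seq (\<gamma> 1) (- \<gamma> 0) = map \<gamma> [1..m]"
proof -
  have "dihedral_m (\<gamma> 1) (- \<gamma> 0) = nat m" by (simp add: dihedral_m_def rotation_order)
  moreover have "s 1 (- \<gamma> 0) = \<gamma> 2" by (simp add: seq_refl linear_neg[OF linear_refl])
  moreover have "\<gamma> (2 + 2 * int (i div 2)) = \<gamma> (1 + int i)" if "odd i" for i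
    using that by (auto elim!: oddE)
  moreover have "\<gamma> (1 + 2 * int (i div 2)) = \<gamma> (1 + int i)" if "even i" for i
    using that by (auto elim!: evenE)
  ultimately show ?thesis
    by (intro nth_equalityI) (simp_all add: rank2_seq_def rotation_funpow nth_upto)
qed

end

section \<open>The dihedral sequence of a pair of roots\<close>

text \<open>The recursion is \<open>\<gamma>_(n+2) = - s(\<gamma>_n)\<close> with \<open>s\<close>
  the reflection in \<open>\<gamma>_(n+1)\<close>, the pairings being replaced by the two
  alternating Cartan integers. Periodicity thus becomes arithmetic of coefficients.\<close>

fun dihedral_seq :: "'v::euclidean_space \<Rightarrow> 'v \<Rightarrow> nat \<Rightarrow> 'v" where
  "dihedral_seq a b 0 = - b"
| "dihedral_seq a b (Suc 0) = a"
| "dihedral_seq a b (Suc (Suc n)) =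
    - (if even n then b \<bullet> coroot a else a \<bullet> coroot b) *\<^sub>R dihedral_seq a b (Suc n) - dihedral_seq a b n"

text \<open>For \<open>x * y\<close> equal to \<open>0, 1, 2, 3\<close> a two-periodic recursion \<open>g (i+1) = c i * g i - g (i-1)\<close> is
  antiperiodic, and \<open>g (i+1), \<dots>, g (i+m)\<close> are nonnegative combinations of \<open>g (i+1)\<close> and \<open>- g i\<close>.\<close>
definition cartan_period :: "real \<Rightarrow> real \<Rightarrow> nat \<Rightarrow> bool" where
  "cartan_period x y m \<longleftrightarrow> x \<ge> 0 \<and> y \<ge> 0 \<and>
    (m = 2 \<and> x = 0 \<and> y = 0 \<or> m = 3 \<and> x = 1 \<and> y = 1 \<or> m = 4 \<and> x * y = 2 \<or> m = 6 \<and> x * y = 3)"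

lemma cartan_period_exists:
  assumes "x \<in> \<int>" "y \<in> \<int>" "x \<ge> 0" "y \<ge> 0" "x * y < 4" "x = 0 \<longleftrightarrow> y = 0"
  shows "\<exists>m. cartan_period x y m"
proof -
  obtain i j where ij: "x = of_int i" "y = of_int j" using assms by (auto elim!: Ints_cases)
  have "i * j < 4" using assms(5) unfolding ij by (metis of_int_mult of_int_less_numeral_iff)
  moreover have "0 \<le> i * j" using assms ij by simp
  ultimately consider "i * j = 0" | "i * j = 1" | "i * j = 2" | "i * j = 3" by linarith
  then show ?thesis
  proof cases
    case 1
    then show ?thesis using assms ij by (auto simp: cartan_period_def)
  next
    case 2
    then have "i = 1" "j = 1" using assms ij by (auto simp: zmult_eq_1_iff)
    then show ?thesis using ij by (auto simp: cartan_period_def)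
  next
    case 3
    then have "x * y = 2" unfolding ij by (metis of_int_mult of_int_numeral)
    then show ?thesis using assms by (auto simp: cartan_period_def)
  next
    case 4
    then have "x * y = 3" unfolding ij by (metis of_int_mult of_int_numeral)
    then show ?thesis using assms by (auto simp: cartan_period_def)
  qed
qed

text \<open>Up to a factor \<open>x\<close> or \<open>y\<close> the coefficients are polynomials in
  \<open>t = x * y\<close>. They are computed through \<open>g 6\<close>, the largest case, and
  evaluated at each admissible \<open>t\<close>.\<close>

lemma cartan_period_recursion:
  fixes g :: "nat \<Rightarrow> 'a::real_vector"
  assumes xy: "cartan_period x y m"
    and rec: "\<And>n. g (Suc (Suc n)) = (if even n then x else y) *\<^sub>R g (Suc n) - g n"
  shows "g m = - g 0"
    and "1 \<le> j \<Longrightarrow> j \<le> m \<Longrightarrow> \<exists>c d. c \<ge> 0 \<and> d \<ge> 0 \<and> (c > 0 \<or> d > 0) \<and> g j = c *\<^sub>R g 1 - d *\<^sub>R g 0"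
proof -
  define A B where "A = g 1" and "B = g 0"
  define t where "t = x * y"
  have comb: "c *\<^sub>R (p *\<^sub>R A - q *\<^sub>R B) - (p' *\<^sub>R A - q' *\<^sub>R B) = (c * p - p') *\<^sub>R A - (c * q - q') *\<^sub>R B" for c p q p' q'
    by (simp add: algebra_simps)
  have g2: "g 2 = x *\<^sub>R A - B"
    using rec[of 0] by (simp add: A_def B_def numeral_2_eq_2)
  have g3: "g 3 = (t - 1) *\<^sub>R A - y *\<^sub>R B"
  proof -
    have "g 3 = y *\<^sub>R g 2 - A" using rec[of 1] by (simp add: eval_nat_numeral A_def)
    then show ?thesis unfolding g2 by (simp add: t_def algebra_simps)
  qed
  have g4: "g 4 = (x * (t - 2)) *\<^sub>R A - (t - 1) *\<^sub>R B"
  proof -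
    have "g 4 = x *\<^sub>R g 3 - g 2" using rec[of 2] by simp
    also have "\<dots> = (x * (t - 1) - x) *\<^sub>R A - (x * y - 1) *\<^sub>R B"
      using comb[of x "t - 1" y x 1] unfolding g2 g3 by simp
    finally show ?thesis by (simp add: t_def algebra_simps)
  qed
  have g5: "g 5 = (t * (t - 2) - (t - 1)) *\<^sub>R A - (y * (t - 2)) *\<^sub>R B"
  proof -
    have "g 5 = y *\<^sub>R g 4 - g 3" using rec[of 3] by simp
    also have "\<dots> = (y * (x * (t - 2)) - (t - 1)) *\<^sub>R A - (y * (t - 1) - y) *\<^sub>R B"
      unfolding g4 g3 by (rule comb)
    finally show ?thesis by (simp add: t_def algebra_simps)
  qed
  have g6: "g 6 = (x * (t - 3) * (t - 1)) *\<^sub>R A - (t * (t - 2) - (t - 1)) *\<^sub>R B"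
  proof -
    have "g 6 = x *\<^sub>R g 5 - g 4" using rec[of 4] by simp
    also have "\<dots> = (x * (t * (t - 2) - (t - 1)) - x * (t - 2)) *\<^sub>R A - (x * (y * (t - 2)) - (t - 1)) *\<^sub>R B"
      unfolding g4 g5 by (rule comb)
    finally show ?thesis by (simp add: t_def algebra_simps)
  qed
  have nn: "x \<ge> 0" "y \<ge> 0" using xy by (auto simp: cartan_period_def)
  consider "m = 2" "x = 0" "y = 0" | "m = 3" "x = 1" "y = 1" | "m = 4" "t = 2" | "m = 6" "t = 3"
    using xy by (auto simp: cartan_period_def t_def)
  note cases = this
  show "g m = - g 0"
    using cases by cases (use g2 g3 g4 g6 in \<open>simp_all add: t_def B_def\<close>)
  have combI: "\<exists>c d. c \<ge> 0 \<and> d \<ge> 0 \<and> (c > 0 \<or> d > 0) \<and> g j = c *\<^sub>R A - d *\<^sub>R B"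
    if "g j = c *\<^sub>R A - d *\<^sub>R B" "c \<ge> 0" "d \<ge> 0" "c > 0 \<or> d > 0" for j c d
    using that by blast
  have g1: "g 1 = 1 *\<^sub>R A - 0 *\<^sub>R B" by (simp add: A_def)
  have g2': "g 2 = x *\<^sub>R A - 1 *\<^sub>R B" using g2 by simp
  assume j: "1 \<le> j" "j \<le> m"
  have "\<exists>c d. c \<ge> 0 \<and> d \<ge> 0 \<and> (c > 0 \<or> d > 0) \<and> g j = c *\<^sub>R A - d *\<^sub>R B"
    using cases
  proof cases
    case 1
    then have "j = 1 \<or> j = 2" using j by auto
    then show ?thesis using combI[OF g1] combI[OF g2'] 1 by auto
  next
    case 2
    then have "j = 1 \<or> j = 2 \<or> j = 3" using j by auto
    then show ?thesis using combI[OF g1] combI[OF g2'] combI[OF g3] 2 by (auto simp: t_def)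
  next
    case 3
    then have "j = 1 \<or> j = 2 \<or> j = 3 \<or> j = 4" using j by auto
    then show ?thesis using combI[OF g1] combI[OF g2'] combI[OF g3] combI[OF g4] 3 nn by auto
  next
    case 4
    then have "j = 1 \<or> j = 2 \<or> j = 3 \<or> j = 4 \<or> j = 5 \<or> j = 6" using j by auto
    then show ?thesis
      using combI[OF g1] combI[OF g2'] combI[OF g3] combI[OF g4] combI[OF g5] combI[OF g6] 4 nn by auto
  qed
  then show "\<exists>c d. c \<ge> 0 \<and> d \<ge> 0 \<and> (c > 0 \<or> d > 0) \<and> g j = c *\<^sub>R g 1 - d *\<^sub>R g 0"
    by (simp add: A_def B_def)
qed

lemma cartan_period_commute: "cartan_period x y m \<longleftrightarrow> cartan_period y x m"
  by (auto simp: cartan_period_def mult.commute)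

lemma cartan_period_pos: "cartan_period x y m \<Longrightarrow> m > 0"
  by (auto simp: cartan_period_def)

lemma two_periodic_extension:
  fixes g :: "nat \<Rightarrow> 'a::real_vector"
  assumes xy: "cartan_period x y m"
    and rec: "\<And>n. g (Suc (Suc n)) = (if even n then x else y) *\<^sub>R g (Suc n) - g n"
  obtains \<gamma> :: "int \<Rightarrow> 'a" where "\<And>n. \<gamma> (int n) = g n"
    "\<And>i. \<gamma> (i + int m) = - \<gamma> i"
    "\<And>i. \<gamma> (i + 1) = (if odd i then x else y) *\<^sub>R \<gamma> i - \<gamma> (i - 1)"
proof -
  have anti: "g (n + m) = - g n" for n
  proof (cases "even n")
    case True
    then show ?thesis using cartan_period_recursion(1)[OF xy, of "\<lambda>k. g (n + k)"] rec[of "n + k" for k]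
      by (simp add: add.commute)
  next
    \<comment> \<open>Starting at an odd index swaps \<open>x\<close> and \<open>y\<close>, and
      \<open>cartan_period\<close> is symmetric in them.\<close>
    case False
    then show ?thesis
      using cartan_period_recursion(1)[OF cartan_period_commute[THEN iffD1, OF xy], of "\<lambda>k. g (n + k)"]
        rec[of "n + k" for k]
      by (simp add: add.commute)
  qed
  have per: "g (n + 2*m*z) = g n" for n z
  proof (induction z)
    case (Suc z)
    have "g (n + 2*m*Suc z) = g (n + 2*m*z + m + m)" by (simp add: algebra_simps)
    then show ?case using Suc by (simp only: anti minus_minus)
  qed simp
  have m: "m > 0" using cartan_period_pos[OF xy] .
  define \<gamma> where "\<gamma> i = g (nat (i mod (2 * int m)))" for i
  have \<gamma>: "\<gamma> (int n + 2 * int m * z) = g n" for n z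
  proof -
    have "nat ((int n + 2 * int m * z) mod (2 * int m)) = n mod (2*m)"
      by (simp add: nat_mod_as_int)
    then have "\<gamma> (int n + 2 * int m * z) = g (n mod (2*m))" by (simp add: \<gamma>_def)
    also have "\<dots> = g (n mod (2*m) + 2*m*(n div (2*m)))" by (simp only: per)
    finally show ?thesis by simp
  qed
  \<comment> \<open>A representative of the form \<open>Suc n\<close> keeps \<open>i - 1\<close>
    among the natural indices as well.\<close>
  have rep: "\<exists>n z. i = int (Suc n) + 2 * int m * z" for i :: int
  proof -
    define q where "q = (i - 1) mod (2 * int m)"
    have "0 \<le> q" using m by (simp add: q_def)
    moreover have "i = q + 1 + 2 * int m * ((i - 1) div (2 * int m))"
      using mult_div_mod_eq[of "2 * int m" "i - 1"] by (simp add: q_def)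
    ultimately have "i = int (Suc (nat q)) + 2 * int m * ((i - 1) div (2 * int m))" by simp
    then show ?thesis by blast
  qed
  show ?thesis
  proof (rule that[of \<gamma>])
    show "\<gamma> (int n) = g n" for n using \<gamma>[of n 0] by simp
    fix i
    obtain n z where i: "i = int (Suc n) + 2 * int m * z" using rep by blast
    have "i + int m = int (Suc n + m) + 2 * int m * z" by (simp add: i)
    then show "\<gamma> (i + int m) = - \<gamma> i" unfolding i by (simp only: \<gamma> anti)
    have "i + 1 = int (Suc (Suc n)) + 2 * int m * z" "i - 1 = int n + 2 * int m * z"
      "odd i \<longleftrightarrow> even n" by (simp_all add: i)
    then show "\<gamma> (i + 1) = (if odd i then x else y) *\<^sub>R \<gamma> i - \<gamma> (i - 1)"
      unfolding i by (simp only: \<gamma> rec)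
  qed
qed

context root_system
begin

text \<open>Excluding \<open>b = - a\<close> keeps the product of the Cartan integers below 4, where
  the recursion is antiperiodic; \<open>b = a\<close> is impossible as
  \<open>a \<bullet> b \<le> 0\<close>.\<close>

lemma dihedral_roots_exist:
  assumes ab: "a \<in> \<Phi>" "b \<in> \<Phi>" "a \<bullet> b \<le> 0" "b \<noteq> - a"
  obtains m \<gamma> where "dihedral_roots \<Phi> \<xi> m \<gamma>" "\<gamma> 0 = - b" "\<gamma> 1 = a"
proof -
  define x y where "x = - (b \<bullet> coroot a)" and "y = - (a \<bullet> coroot b)"
  have pos: "a \<bullet> a > 0" "b \<bullet> b > 0" using ab zero_notin_roots by auto
  have "b \<noteq> a" using ab(3) pos(1) by (metis not_less)
  then have "x * y < 4" using cartan_prod_less_4[OF ab(1,2)] ab by (simp add: x_def y_def)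
  moreover have "x \<in> \<int>" "y \<in> \<int>" using integral ab by (simp_all add: x_def y_def)
  moreover have xd: "x * (a \<bullet> a) = - 2 * (a \<bullet> b)" "y * (b \<bullet> b) = - 2 * (a \<bullet> b)"
    using pos by (simp_all add: x_def y_def coroot_def inner_commute)
  moreover have "x \<ge> 0" "y \<ge> 0" "x = 0 \<longleftrightarrow> y = 0"
    using ab(3) pos by (auto simp: x_def y_def coroot_def inner_commute intro!: divide_nonpos_nonneg)
  ultimately obtain m where m: "cartan_period x y m" using cartan_period_exists by blast
  have rec0: "dihedral_seq a b (Suc (Suc n)) = (if even n then x else y) *\<^sub>R dihedral_seq a b (Suc n) - dihedral_seq a b n" for n
    by (simp add: x_def y_def)
  obtain \<gamma> where \<gamma>n: "\<And>n. \<gamma> (int n) = dihedral_seq a b n"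
    and anti: "\<And>i. \<gamma> (i + int m) = - \<gamma> i"
    and rec: "\<And>i. \<gamma> (i + 1) = (if odd i then x else y) *\<^sub>R \<gamma> i - \<gamma> (i - 1)"
    using two_periodic_extension[OF m rec0] by blast
  have \<gamma>01: "\<gamma> 0 = - b" "\<gamma> 1 = a" using \<gamma>n[of 0] \<gamma>n[of 1] by simp_all
  \<comment> \<open>Along the sequence the Cartan integers \<open>c\<close> and the squared lengths
    \<open>q\<close> alternate with the parity of the index.\<close>
  define c where "c i = (if odd i then x else y)" for i :: int
  define q where "q i = (if odd i then a \<bullet> a else b \<bullet> b)" for i :: int
  have rec: "\<gamma> (i + 1) = c i *\<^sub>R \<gamma> i - \<gamma> (i - 1)" for i using rec by (simp add: c_def)
  have cq: "c i * q i = - 2 * (a \<bullet> b)" for i using xd by (simp add: c_def q_def)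
  have qpos: "q i > 0" for i using pos by (simp add: q_def)
  have step: "w \<bullet> w = u \<bullet> u \<and> v \<bullet> w = d"
    if "w = r *\<^sub>R v - u" "u \<bullet> v = d" "r * (v \<bullet> v) = 2 * d" for u v w :: 'v and r d
  proof -
    have vw: "v \<bullet> w = d" using that by (simp add: inner_diff_right inner_commute)
    have "w \<bullet> w = r * (v \<bullet> w) - u \<bullet> w" by (subst that(1)) (simp add: inner_diff_left)
    also have "u \<bullet> w = r * d - u \<bullet> u" using that by (simp add: inner_diff_right)
    finally show ?thesis using vw by simp
  qed
  have inner: "\<gamma> i \<bullet> \<gamma> i = q i \<and> \<gamma> (i+1) \<bullet> \<gamma> (i+1) = q (i+1) \<and> \<gamma> i \<bullet> \<gamma> (i+1) = - (a \<bullet> b)" for i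
  proof (induction i rule: int_induct[where k = 0])
    case base
    then show ?case by (simp add: \<gamma>01 q_def inner_commute)
  next
    case (step1 i)
    have "\<gamma> (i+1+1) = c (i+1) *\<^sub>R \<gamma> (i+1) - \<gamma> i" using rec[of "i+1"] by simp
    then have "\<gamma> (i+1+1) \<bullet> \<gamma> (i+1+1) = \<gamma> i \<bullet> \<gamma> i \<and> \<gamma> (i+1) \<bullet> \<gamma> (i+1+1) = - (a \<bullet> b)"
      by (rule step) (use step1 cq[of "i+1"] in auto)
    moreover have "q (i+1+1) = q i" by (simp add: q_def)
    ultimately show ?case using step1 by simp
  next
    case (step2 i)
    have "\<gamma> (i-1) = c i *\<^sub>R \<gamma> i - \<gamma> (i+1)" using rec[of i] by simp
    then have "\<gamma> (i-1) \<bullet> \<gamma> (i-1) = \<gamma> (i+1) \<bullet> \<gamma> (i+1) \<and> \<gamma> i \<bullet> \<gamma> (i-1) = - (a \<bullet> b)"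
      by (rule step) (use step2 cq[of i] in \<open>auto simp: inner_commute\<close>)
    moreover have "q (i-1) = q (i+1)" by (simp add: q_def)
    ultimately show ?case using step2 by (simp add: inner_commute)
  qed
  have adj: "refl (\<gamma> i) (\<gamma> (i-1)) = - \<gamma> (i+1)" for i
  proof -
    have "\<gamma> (i-1) \<bullet> \<gamma> i = - (a \<bullet> b)" "\<gamma> i \<bullet> \<gamma> i = q i" using inner[of "i-1"] inner[of i] by simp_all
    then have "\<gamma> (i-1) \<bullet> coroot (\<gamma> i) = c i" using cq[of i] qpos[of i] by (simp add: coroot_def field_simps)
    then show ?thesis by (simp add: refl_def rec)
  qed
  have adj': "refl (\<gamma> i) (\<gamma> (i+1)) = - \<gamma> (i-1)" for i
    using arg_cong[OF adj, of "refl (\<gamma> i)" i] by (simp add: linear_neg[OF linear_refl])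
  have up: "refl (\<gamma> i) (\<gamma> (i + int n)) = - \<gamma> (i - int n) \<and> refl (\<gamma> i) (\<gamma> (i + int n + 1)) = - \<gamma> (i - int n - 1)" for i n
  proof (induction n)
    case 0
    then show ?case using adj' by simp
  next
    case (Suc n)
    define e where "e = c (i + int n + 1)"
    \<comment> \<open>The two indices have equal parity, so the recursion is the same in both
      directions from \<open>i\<close> and the reflection can exchange them.\<close>
    have "e = c (i - int n - 1)" by (simp add: e_def c_def)
    then have dn: "\<gamma> (i - int n - 2) = e *\<^sub>R \<gamma> (i - int n - 1) - \<gamma> (i - int n)"
      using rec[of "i - int n - 1"] by simp
    have "\<gamma> (i + int n + 2) = e *\<^sub>R \<gamma> (i + int n + 1) - \<gamma> (i + int n)"
      using rec[of "i + int n + 1"] by (simp add: e_def add.commute[of 2])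
    then have "refl (\<gamma> i) (\<gamma> (i + int n + 2)) = - \<gamma> (i - int n - 2)"
      using Suc dn by (simp add: linear_diff[OF linear_refl] linear_scale[OF linear_refl])
    then show ?case using Suc by (simp add: algebra_simps)
  qed
  have refl: "refl (\<gamma> i) (\<gamma> j) = - \<gamma> (2*i - j)" for i j
  proof (cases "j \<ge> i")
    case True
    then show ?thesis using up[of i "nat (j - i)"] by simp
  next
    case False
    then have "refl (\<gamma> i) (\<gamma> (2*i - j)) = - \<gamma> j" using up[of i "nat (i - j)"] by (simp add: algebra_simps)
    from arg_cong[OF this, of "refl (\<gamma> i)"] show ?thesis by (simp add: linear_neg[OF linear_refl])
  qed
  have root: "\<gamma> i \<in> \<Phi> \<and> \<gamma> (i+1) \<in> \<Phi>" for i
  proof (induction i rule: int_induct[where k = 0])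
    case base
    then show ?case using ab by (simp add: \<gamma>01)
  next
    case (step1 i)
    then show ?case using refl_closed[of "\<gamma> (i+1)" "\<gamma> i"] adj[of "i+1"] by simp
  next
    case (step2 i)
    then show ?case using refl_closed[of "\<gamma> i" "\<gamma> (i+1)"] adj'[of i] by simp
  qed
  have interval: "\<exists>p. \<forall>j. p < j \<and> j \<le> p + int m \<longrightarrow> u (\<gamma> j) \<bullet> \<xi> > 0" if u: "u \<in> weyl \<Phi>" for u
  proof -
    note lin = weyl_linear[OF u]
    define L where "L i = u (\<gamma> i) \<bullet> \<xi>" for i
    have nz: "L i \<noteq> 0" for i using regular[OF weyl_root[OF u]] root by (simp add: L_def)
    have Lanti: "L (i + int m) = - L i" for i by (simp add: L_def anti linear_neg[OF lin])
    \<comment> \<open>If no sign change from negative to positive occurred, a negative value would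
      persist forever, against antiperiodicity.\<close>
    have "\<exists>p. L p < 0 \<and> L (p+1) > 0"
    proof (rule ccontr)
      assume "\<not> ?thesis"
      then have step: "L p < 0 \<Longrightarrow> L (p + 1) < 0" for p using nz[of "p+1"] by (meson linorder_neqE)
      have neg: "L p < 0 \<Longrightarrow> L (p + int n) < 0" for p n
        by (induction n) (use step in \<open>auto simp: add.assoc[symmetric] add.commute[of 1]\<close>)
      have "\<not> L 0 < 0" "\<not> L (int m) < 0"
        using neg[of 0 m] neg[of "int m" m] Lanti[of 0] Lanti[of "int m"] by auto
      then show False using Lanti[of 0] nz[of 0] by simp
    qed
    then obtain p where p: "L p < 0" "L (p+1) > 0" by blast
    have "L j > 0" if j: "p < j" "j \<le> p + int m" for j
    proof -
      define n where "n = nat (j - p)"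
      have n: "1 \<le> n" "n \<le> m" "j = p + int n" using j by (auto simp: n_def)
      \<comment> \<open>Restarted at \<open>p\<close>, the recursion writes
        \<open>\<gamma> j\<close> as a nonzero nonnegative combination of
        \<open>\<gamma> (p+1)\<close> and \<open>- \<gamma> p\<close>, both of which
        \<open>u\<close> sends to positive roots.\<close>
      have "cartan_period (c (p+1)) (c p) m" using m cartan_period_commute by (auto simp: c_def)
      moreover have "\<gamma> (p + int (Suc (Suc k))) = (if even k then c (p+1) else c p) *\<^sub>R \<gamma> (p + int (Suc k)) - \<gamma> (p + int k)" for k
        using rec[of "p + int k + 1"] by (simp add: c_def algebra_simps)
      ultimately obtain d e where de: "d \<ge> 0" "e \<ge> 0" "d > 0 \<or> e > 0" "\<gamma> j = d *\<^sub>R \<gamma> (p + 1) - e *\<^sub>R \<gamma> p"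
        using cartan_period_recursion(2)[of "c (p+1)" "c p" m "\<lambda>k. \<gamma> (p + int k)" n] n by auto
      have "L j = d * L (p+1) + e * (- L p)"
        by (simp add: L_def de(4) linear_diff[OF lin] linear_scale[OF lin] inner_diff_left)
      moreover have "d * L (p+1) \<ge> 0" "e * (- L p) \<ge> 0" using de p by (auto simp: mult_nonneg_nonpos)
      moreover have "d * L (p+1) > 0 \<or> e * (- L p) > 0" using de(3) p by (metis mult_pos_pos neg_0_less_iff_less)
      ultimately show ?thesis by linarith
    qed
    then show ?thesis unfolding L_def by blast
  qed
  have "dihedral_roots \<Phi> \<xi> (int m) \<gamma>"
    by unfold_locales (use anti refl root interval cartan_period_pos[OF m] in auto)
  then show ?thesis using that \<gamma>01 by blast
qed

end

theorem theorem10p1: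
  fixes \<Phi> :: "'v::euclidean_space set" and \<xi> l :: 'v and k :: int
  assumes "irreducible_root_system \<Phi>"
    and "\<forall>a\<in>\<Phi>. a \<bullet> \<xi> \<noteq> 0"
    and "l \<in> weight_lattice \<Phi>"
  shows "(\<forall>a\<in>\<Phi>. Rop \<Phi> \<xi> l k a ` Kmod \<Phi> \<xi> \<subseteq> Kmod \<Phi> \<xi>)
    \<and> (\<forall>a\<in>\<Phi>. \<forall>f\<in>Kmod \<Phi> \<xi>. Rop \<Phi> \<xi> l k a f =
          Xop \<Phi> \<xi> l (\<lambda>u. Xop \<Phi> \<xi> (of_int k *\<^sub>R a) (Xop \<Phi> \<xi> (- l) f) u
                         + Bop \<Phi> \<xi> a (Xop \<Phi> \<xi> (- l) f) u))
    \<and> (\<forall>a\<in>\<Phi>. \<forall>f\<in>Kmod \<Phi> \<xi>. Rop \<Phi> \<xi> l k (- a) (Rop \<Phi> \<xi> l k a f) = f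
                           \<and> Rop \<Phi> \<xi> l k a (Rop \<Phi> \<xi> l k (- a) f) = f)
    \<and> (\<forall>a\<in>\<Phi>. \<forall>b\<in>\<Phi>. a \<bullet> b \<le> 0 \<and> b \<noteq> - a \<longrightarrow>
          (\<forall>f\<in>Kmod \<Phi> \<xi>. op_prod (Rop \<Phi> \<xi> l k) (rank2_seq a b) f
                        = op_prod (Rop \<Phi> \<xi> l k) (rev (rank2_seq a b)) f))"
proof (intro conjI ballI impI)
  interpret root_system \<Phi> \<xi>
    using assms by unfold_locales auto
  show "Rop \<Phi> \<xi> l k a ` Kmod \<Phi> \<xi> \<subseteq> Kmod \<Phi> \<xi>" if "a \<in> \<Phi>" for a
    using Rop_Kmod that assms(3) by blast
  show "Rop \<Phi> \<xi> l k a f = Xop \<Phi> \<xi> l (\<lambda>u. Xop \<Phi> \<xi> (of_int k *\<^sub>R a) (Xop \<Phi> \<xi> (- l) f) u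
      + Bop \<Phi> \<xi> a (Xop \<Phi> \<xi> (- l) f) u)" if "a \<in> \<Phi>" "f \<in> Kmod \<Phi> \<xi>" for a f
    using Rop_conj that supported_Kmod by blast
  show "Rop \<Phi> \<xi> l k (- a) (Rop \<Phi> \<xi> l k a f) = f" if "a \<in> \<Phi>" "f \<in> Kmod \<Phi> \<xi>" for a f
    using Rop_inverse that supported_Kmod by blast
  show "Rop \<Phi> \<xi> l k a (Rop \<Phi> \<xi> l k (- a) f) = f" if "a \<in> \<Phi>" "f \<in> Kmod \<Phi> \<xi>" for a f
    using Rop_inverse[of "- a" f l k] that supported_Kmod by simp
  fix a b f
  assume ab: "a \<in> \<Phi>" "b \<in> \<Phi>" "a \<bullet> b \<le> 0 \<and> b \<noteq> - a" and f: "f \<in> Kmod \<Phi> \<xi>"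
  then obtain m \<gamma> where d: "dihedral_roots \<Phi> \<xi> m \<gamma>" "\<gamma> 0 = - b" "\<gamma> 1 = a"
    using dihedral_roots_exist by blast
  interpret d: dihedral_roots \<Phi> \<xi> m \<gamma> by (rule d(1))
  show "op_prod (Rop \<Phi> \<xi> l k) (rank2_seq a b) f = op_prod (Rop \<Phi> \<xi> l k) (rev (rank2_seq a b)) f"
    using d.op_prod_yang_baxter[OF supported_Kmod[OF f]] d.rank2_seq_eq d(2,3) by simp
qed

end
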